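(* Let $(X_1,x_1)$ and $(X_2,x_2)$ be two pointed spaces, $(X,x_* )=(X_1,x_1)\vee(X_2,x_2)$, and $n\ge 2$. If $X$ is semilocally $n$-simply connected at $x_*$, then $$\mathcal{H}_n(X,x_* )\cong j_*\mathcal{H}_n(U_1\vee U_2,x_* )\oplus\bigoplus_{\mathbb{N}}\pi_n(X,x_* )$$ for some neighbourhood $U_1\vee U_2$ of $x_*$ in $X$ (with $U_i$ a neighbourhood of $x_i$ in $X_i$, $i=1,2$), where $j:U_1\vee U_2\to X$ is the inclusion map.
   Context: For $n\ge 1$ the $n$-dimensional Hawaiian earring is $\mathbb{HE}^n=\{(r_0,\dots,r_n)\in\mathbb{R}^{n+1} : (r_0-1/k)^2+\sum_{i=1}^n r_i^2=(1/k)^2 \text{ for some } k\in\mathbb{N}\}$, with base point $\theta=(0,\dots,0)$; $\mathbb{S}^n_k$ denotes its sphere of radius $1/k$. All homotopies are relative to base points. The $n$th Hawaiian group $\mathcal{H}_n(X,x_0)$ is the set of pointed homotopy classes $[f]$ of pointed maps $f:(\mathbb{HE}^n,\theta)\to(X,x_0)$, with the operation induced sphere by sphere from that of the $n$th homotopy group: $[f][g]=[f*g]$, where $(f*g)|_{\mathbb{S}^n_k}=f|_{\mathbb{S}^n_k}*g|_{\mathbb{S}^n_k}$ for all $k$. For $n\ge 2$ this group is abelian. A pointed map $\beta$ induces a homomorphism $\beta_*:[f]\mapsto[\beta\circ f]$ of Hawaiian groups; in particular $j_*\mathcal{H}_n(U_1\vee U_2,x_* )$ is a subgroup of $\mathcal{H}_n(X,x_*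 )$. $X$ is semilocally $n$-simply connected at $x$ if there is a neighbourhood $U$ of $x$ such that the homomorphism $\pi_n(U,x)\to\pi_n(X,x)$ induced by inclusion is trivial. *)

theory Defs
  imports "HOL-Analysis.Analysis" "HOL-Algebra.Elementary_Groups" "HOL-Algebra.Product_Groups"
begin

section \<open>Neighbourhoods and wedges\<close>

text \<open>Neighbourhoods are not required to be open.\<close>

definition is_nbhd :: "'a topology \<Rightarrow> 'a \<Rightarrow> 'a set \<Rightarrow> bool" where
  "is_nbhd X x U \<longleftrightarrow> U \<subseteq> topspace X \<and> (\<exists>V. openin X V \<and> x \<in> V \<and> V \<subseteq> U)"

text \<open>
  The wedge is the quotient of the disjoint union of \<open>X1\<close> and \<open>X2\<close> that identifies \<open>x1\<close> with
  \<open>x2\<close>. The class of the two base points is represented by \<open>Inl x1\<close>; every other class is a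
  singleton. The two maps below are the canonical maps of the summands into the quotient,
  and the topology is the final one with respect to them.
\<close>

definition wedge_in1 :: "'a \<Rightarrow> 'a + 'b" where
  "wedge_in1 a = Inl a"

definition wedge_in2 :: "'a \<Rightarrow> 'b \<Rightarrow> 'b \<Rightarrow> 'a + 'b" where
  "wedge_in2 x1 x2 b = (if b = x2 then Inl x1 else Inr b)"

definition wedge_set :: "'a set \<Rightarrow> 'a \<Rightarrow> 'b set \<Rightarrow> 'b \<Rightarrow> ('a + 'b) set" where
  "wedge_set A x1 B x2 = wedge_in1 ` A \<union> wedge_in2 x1 x2 ` B"

definition wedge :: "'a topology \<Rightarrow> 'a \<Rightarrow> 'b topology \<Rightarrow> 'b \<Rightarrow> ('a + 'b) topology" where
  "wedge X1 x1 X2 x2 = topology (\<lambda>W. W \<subseteq> wedge_set (topspace X1) x1 (topspace X2) x2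
      \<and> openin X1 {a \<in> topspace X1. wedge_in1 a \<in> W}
      \<and> openin X2 {b \<in> topspace X2. wedge_in2 x1 x2 b \<in> W})"

definition wedge_base :: "'a \<Rightarrow> 'a + 'b" where
  "wedge_base x1 = Inl x1"

lemma Inl_in_wedge_set: "Inl c \<in> wedge_set A x1 B x2 \<longleftrightarrow> c \<in> A \<or> c = x1 \<and> x2 \<in> B"
  and Inr_in_wedge_set: "Inr d \<in> wedge_set A x1 B x2 \<longleftrightarrow> d \<in> B \<and> d \<noteq> x2"
  by (auto simp: wedge_set_def wedge_in1_def wedge_in2_def split: if_splits)

lemma openin_wedge:
  "openin (wedge X1 x1 X2 x2) W \<longleftrightarrow> W \<subseteq> wedge_set (topspace X1) x1 (topspace X2) x2
      \<and> openin X1 {a \<in> topspace X1. wedge_in1 a \<in> W}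
      \<and> openin X2 {b \<in> topspace X2. wedge_in2 x1 x2 b \<in> W}"
proof -
  let ?P = "\<lambda>W. W \<subseteq> wedge_set (topspace X1) x1 (topspace X2) x2
      \<and> openin X1 {a \<in> topspace X1. wedge_in1 a \<in> W}
      \<and> openin X2 {b \<in> topspace X2. wedge_in2 x1 x2 b \<in> W}"
  have "istopology ?P"
    unfolding istopology_def
  proof (intro conjI allI impI)
    fix S T assume S: "?P S" and T: "?P T"
    have "{a \<in> topspace X1. wedge_in1 a \<in> S \<inter> T}
            = {a \<in> topspace X1. wedge_in1 a \<in> S} \<inter> {a \<in> topspace X1. wedge_in1 a \<in> T}"
         "{b \<in> topspace X2. wedge_in2 x1 x2 b \<in> S \<inter> T}
            = {b \<in> topspace X2. wedge_in2 x1 x2 b \<in> S} \<inter> {b \<in> topspace X2. wedge_in2 x1 x2 b \<in> T}"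
      by auto
    then show "openin X1 {a \<in> topspace X1. wedge_in1 a \<in> S \<inter> T}"
      "openin X2 {b \<in> topspace X2. wedge_in2 x1 x2 b \<in> S \<inter> T}"
      using S T by (simp_all only: openin_Int)
    show "S \<inter> T \<subseteq> wedge_set (topspace X1) x1 (topspace X2) x2" using S by auto
  next
    fix \<K> assume K: "\<forall>W\<in>\<K>. ?P W"
    have "{a \<in> topspace X1. wedge_in1 a \<in> \<Union>\<K>} = (\<Union>W\<in>\<K>. {a \<in> topspace X1. wedge_in1 a \<in> W})"
         "{b \<in> topspace X2. wedge_in2 x1 x2 b \<in> \<Union>\<K>} = (\<Union>W\<in>\<K>. {b \<in> topspace X2. wedge_in2 x1 x2 b \<in> W})"
      by auto
    then show "openin X1 {a \<in> topspace X1. wedge_in1 a \<in> \<Union>\<K>}"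
      "openin X2 {b \<in> topspace X2. wedge_in2 x1 x2 b \<in> \<Union>\<K>}"
      using K by (simp_all only:) (rule openin_Union, blast)+
    show "\<Union>\<K> \<subseteq> wedge_set (topspace X1) x1 (topspace X2) x2" using K by blast
  qed
  from topology_inverse'[OF this] show ?thesis
    unfolding wedge_def by (rule fun_cong)
qed

lemma topspace_wedge: "topspace (wedge X1 x1 X2 x2) = wedge_set (topspace X1) x1 (topspace X2) x2"
proof (rule antisym)
  show "topspace (wedge X1 x1 X2 x2) \<subseteq> wedge_set (topspace X1) x1 (topspace X2) x2"
    by (rule openin_wedge[THEN iffD1, OF openin_topspace, THEN conjunct1])
  have "{a \<in> topspace X1. wedge_in1 a \<in> wedge_set (topspace X1) x1 (topspace X2) x2} = topspace X1"
    "{b \<in> topspace X2. wedge_in2 x1 x2 b \<in> wedge_set (topspace X1) x1 (topspace X2) x2} = topspace X2"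
    by (auto simp: wedge_set_def)
  then have "openin (wedge X1 x1 X2 x2) (wedge_set (topspace X1) x1 (topspace X2) x2)"
    unfolding openin_wedge by (simp only: openin_topspace subset_refl simp_thms)
  then show "wedge_set (topspace X1) x1 (topspace X2) x2 \<subseteq> topspace (wedge X1 x1 X2 x2)"
    by (rule openin_subset)
qed

text \<open>A wedge of subspaces containing the base points is a subspace of the wedge.\<close>

lemma wedge_subtopology:
  assumes "x1 \<in> U1" "U1 \<subseteq> topspace X1" "x2 \<in> U2" "U2 \<subseteq> topspace X2"
  shows "wedge (subtopology X1 U1) x1 (subtopology X2 U2) x2
           = subtopology (wedge X1 x1 X2 x2) (wedge_set U1 x1 U2 x2)"
proof -
  have top: "topspace (subtopology X1 U1) = U1" "topspace (subtopology X2 U2) = U2"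
    using assms by auto
  have "openin (wedge (subtopology X1 U1) x1 (subtopology X2 U2) x2) W
     \<longleftrightarrow> openin (subtopology (wedge X1 x1 X2 x2) (wedge_set U1 x1 U2 x2)) W" (is "?L \<longleftrightarrow> ?R") for W
  proof
    assume L: ?L
    then have W: "W \<subseteq> wedge_set U1 x1 U2 x2"
      and "openin (subtopology X1 U1) {a \<in> U1. wedge_in1 a \<in> W}"
      and "openin (subtopology X2 U2) {b \<in> U2. wedge_in2 x1 x2 b \<in> W}"
      unfolding openin_wedge top by auto
    then obtain O1 O2 where O: "openin X1 O1" "{a \<in> U1. wedge_in1 a \<in> W} = O1 \<inter> U1"
        "openin X2 O2" "{b \<in> U2. wedge_in2 x1 x2 b \<in> W} = O2 \<inter> U2"
      unfolding openin_subtopology by auto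
    have x: "x1 \<in> O1 \<longleftrightarrow> x2 \<in> O2"
    proof -
      have "x1 \<in> {a \<in> U1. wedge_in1 a \<in> W} \<longleftrightarrow> x1 \<in> O1 \<inter> U1"
        "x2 \<in> {b \<in> U2. wedge_in2 x1 x2 b \<in> W} \<longleftrightarrow> x2 \<in> O2 \<inter> U2"
        by (simp_all only: O(2,4))
      with assms(1,3) show ?thesis by (simp add: wedge_in1_def wedge_in2_def)
    qed
    have sub: "O1 \<subseteq> topspace X1" "O2 \<subseteq> topspace X2"
      using O(1,3) by (simp_all add: openin_subset)
    have "{a \<in> topspace X1. wedge_in1 a \<in> wedge_set O1 x1 O2 x2} = O1"
      "{b \<in> topspace X2. wedge_in2 x1 x2 b \<in> wedge_set O1 x1 O2 x2} = O2"
      using x subsetD[OF sub(1)] subsetD[OF sub(2)]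
      by (auto simp: Inl_in_wedge_set Inr_in_wedge_set wedge_in1_def wedge_in2_def)
    moreover have "wedge_set O1 x1 O2 x2 \<subseteq> wedge_set (topspace X1) x1 (topspace X2) x2"
      using sub by (auto simp: wedge_set_def)
    ultimately have 1: "openin (wedge X1 x1 X2 x2) (wedge_set O1 x1 O2 x2)"
      unfolding openin_wedge using O(1,3) by simp
    have "W = wedge_set O1 x1 O2 x2 \<inter> wedge_set U1 x1 U2 x2"
    proof (rule Set.set_eqI)
      fix w :: "'a + 'b"
      have a: "Inl a \<in> W \<longleftrightarrow> a \<in> O1" if "a \<in> U1" for a
      proof -
        have "a \<in> {a \<in> U1. wedge_in1 a \<in> W} \<longleftrightarrow> a \<in> O1 \<inter> U1"
          by (simp only: O(2))
        with that show ?thesis by (simp add: wedge_in1_def)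
      qed
      have b: "Inr b \<in> W \<longleftrightarrow> b \<in> O2" if "b \<in> U2" "b \<noteq> x2" for b
      proof -
        have "b \<in> {b \<in> U2. wedge_in2 x1 x2 b \<in> W} \<longleftrightarrow> b \<in> O2 \<inter> U2"
          by (simp only: O(4))
        with that show ?thesis by (simp add: wedge_in2_def)
      qed
      show "w \<in> W \<longleftrightarrow> w \<in> wedge_set O1 x1 O2 x2 \<inter> wedge_set U1 x1 U2 x2"
      proof (cases w)
        case (Inl c)
        have "c \<in> U1" if "Inl c \<in> W"
          using subsetD[OF W that] assms(1) by (auto simp: Inl_in_wedge_set)
        then show ?thesis
          using a[of c] x assms(1) by (auto simp: Inl Inl_in_wedge_set)
      next
        case (Inr d)
        have "d \<in> U2 \<and> d \<noteq> x2" if "Inr d \<in> W"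
          using subsetD[OF W that] by (simp add: Inr_in_wedge_set)
        then show ?thesis
          using b[of d] by (auto simp: Inr Inr_in_wedge_set)
      qed
    qed
    with 1 show ?R unfolding openin_subtopology by blast
  next
    assume ?R
    then obtain V where V: "openin (wedge X1 x1 X2 x2) V" "W = V \<inter> wedge_set U1 x1 U2 x2"
      unfolding openin_subtopology by auto
    have "{a \<in> U1. wedge_in1 a \<in> W} = {a \<in> topspace X1. wedge_in1 a \<in> V} \<inter> U1"
      "{b \<in> U2. wedge_in2 x1 x2 b \<in> W} = {b \<in> topspace X2. wedge_in2 x1 x2 b \<in> V} \<inter> U2"
      using assms by (auto simp: V(2) wedge_set_def)
    moreover have "openin X1 {a \<in> topspace X1. wedge_in1 a \<in> V}"
      "openin X2 {b \<in> topspace X2. wedge_in2 x1 x2 b \<in> V}"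
      using V(1) by (simp_all add: openin_wedge)
    ultimately have "openin (subtopology X1 U1) {a \<in> U1. wedge_in1 a \<in> W}"
      "openin (subtopology X2 U2) {b \<in> U2. wedge_in2 x1 x2 b \<in> W}"
      unfolding openin_subtopology by blast+
    then show ?L
      unfolding openin_wedge top using V(2) by simp
  qed
  then show ?thesis
    by (intro topology_eq[THEN iffD2] allI)
qed

section \<open>Homotopy groups\<close>

definition cube :: "nat \<Rightarrow> (nat \<Rightarrow> real) set" where
  "cube n = {t. (\<forall>i<n. 0 \<le> t i \<and> t i \<le> 1) \<and> (\<forall>i\<ge>n. t i = 0)}"

definition cube_boundary :: "nat \<Rightarrow> (nat \<Rightarrow> real) set" where
  "cube_boundary n = {t \<in> cube n. \<exists>i<n. t i = 0 \<or> t i = 1}"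

definition cube_top :: "nat \<Rightarrow> (nat \<Rightarrow> real) topology" where
  "cube_top n = subtopology (Euclidean_space n) (cube n)"

definition cube_map :: "nat \<Rightarrow> 'a topology \<Rightarrow> 'a \<Rightarrow> ((nat \<Rightarrow> real) \<Rightarrow> 'a) \<Rightarrow> bool" where
  "cube_map n X x0 f \<longleftrightarrow> continuous_map (cube_top n) X f \<and> (\<forall>t\<in>cube_boundary n. f t = x0)"

definition cube_class :: "nat \<Rightarrow> 'a topology \<Rightarrow> 'a \<Rightarrow> ((nat \<Rightarrow> real) \<Rightarrow> 'a) \<Rightarrow> ((nat \<Rightarrow> real) \<Rightarrow> 'a) set" where
  "cube_class n X x0 f =
     {g. homotopic_with (\<lambda>h. \<forall>t\<in>cube_boundary n. h t = x0) (cube_top n) X f g}"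

definition cube_concat :: "((nat \<Rightarrow> real) \<Rightarrow> 'a) \<Rightarrow> ((nat \<Rightarrow> real) \<Rightarrow> 'a) \<Rightarrow> (nat \<Rightarrow> real) \<Rightarrow> 'a" where
  "cube_concat f g t = (if t 0 \<le> 1/2 then f (t(0 := 2 * t 0)) else g (t(0 := 2 * t 0 - 1)))"

text \<open>
  In the group operations and induced maps below, the union ranges over all representatives
  of the given classes; all its members are one and the same class.
\<close>

definition homotopy_group :: "nat \<Rightarrow> 'a topology \<Rightarrow> 'a \<Rightarrow> ((nat \<Rightarrow> real) \<Rightarrow> 'a) set monoid" where
  "homotopy_group n X x0 =
     \<lparr>carrier = {cube_class n X x0 f | f. cube_map n X x0 f},
      monoid.mult = (\<lambda>A B. \<Union>f\<in>A. \<Union>g\<in>B. cube_class n X x0 (cube_concat f g)),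
      one = cube_class n X x0 (\<lambda>_. x0)\<rparr>"

definition homotopy_group_induced ::
  "nat \<Rightarrow> 'b topology \<Rightarrow> 'b \<Rightarrow> ('a \<Rightarrow> 'b) \<Rightarrow> ((nat \<Rightarrow> real) \<Rightarrow> 'a) set \<Rightarrow> ((nat \<Rightarrow> real) \<Rightarrow> 'b) set" where
  "homotopy_group_induced n Y y0 \<beta> A = (\<Union>f\<in>A. cube_class n Y y0 (\<beta> \<circ> f))"

definition semilocally_simply_connected_at :: "nat \<Rightarrow> 'a topology \<Rightarrow> 'a \<Rightarrow> bool" where
  "semilocally_simply_connected_at n X x \<longleftrightarrow>
     (\<exists>U. is_nbhd X x U \<and>
        trivial_homomorphism (homotopy_group n (subtopology X U) x) (homotopy_group n X x)
          (homotopy_group_induced n X x id))"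

section \<open>Hawaiian groups\<close>

definition HE :: "nat \<Rightarrow> (nat \<Rightarrow> real) set" where
  "HE n = {r \<in> topspace (Euclidean_space (Suc n)).
     \<exists>k\<ge>1. (r 0 - 1 / real k)\<^sup>2 + (\<Sum>i=1..n. (r i)\<^sup>2) = (1 / real k)\<^sup>2}"

definition HE_base :: "nat \<Rightarrow> real" where
  "HE_base = (\<lambda>_. 0)"

definition HE_top :: "nat \<Rightarrow> (nat \<Rightarrow> real) topology" where
  "HE_top n = subtopology (Euclidean_space (Suc n)) (HE n)"

definition HE_map :: "nat \<Rightarrow> 'a topology \<Rightarrow> 'a \<Rightarrow> ((nat \<Rightarrow> real) \<Rightarrow> 'a) \<Rightarrow> bool" where
  "HE_map n X x0 f \<longleftrightarrow> continuous_map (HE_top n) X f \<and> f HE_base = x0"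

definition HE_class :: "nat \<Rightarrow> 'a topology \<Rightarrow> 'a \<Rightarrow> ((nat \<Rightarrow> real) \<Rightarrow> 'a) \<Rightarrow> ((nat \<Rightarrow> real) \<Rightarrow> 'a) set" where
  "HE_class n X x0 f = {g. homotopic_with (\<lambda>h. h HE_base = x0) (HE_top n) X f g}"

text \<open>
  The operation of the \<open>n\<close>th homotopy group is transported to maps on the \<open>k\<close>th sphere along an
  explicit identification of that sphere with the cube modulo its boundary. Put
  \<open>u = 2 t - 1\<close> and let \<open>b\<close> be the product of the \<open>1 - u\<^sub>i\<^sup>2\<close>, which vanishes exactly on the
  boundary. The interior of the cube is mapped bijectively onto \<open>n\<close>-space by \<open>y = u / b\<close>, and
  \<open>y\<close> is sent to the point \<open>(2/k) (1, y) / (1 + |y|\<^sup>2)\<close> of the sphere (inverse stereographic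
  projection from the base point). Clearing denominators yields a formula that also covers the
  boundary, which goes to the base point.
\<close>

definition bump :: "nat \<Rightarrow> (nat \<Rightarrow> real) \<Rightarrow> real" where
  "bump n t = (\<Prod>i<n. 1 - (2 * t i - 1)\<^sup>2)"

definition sphere_char :: "nat \<Rightarrow> nat \<Rightarrow> (nat \<Rightarrow> real) \<Rightarrow> (nat \<Rightarrow> real)" where
  "sphere_char n k t = (\<lambda>i.
     (2 / real k) * bump n t * (if i = 0 then bump n t else if i \<le> n then 2 * t (i - 1) - 1 else 0)
       / ((bump n t)\<^sup>2 + (\<Sum>j<n. (2 * t j - 1)\<^sup>2)))"

text \<open>
  Only the base point is attained more than once; there every choice of parameters gives
  the common value of \<open>f\<close> and \<open>g\<close>: see \<open>HE_concat_sphere_char\<close> below, which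
  together with \<open>image_sphere_char\<close> characterises this operation.
\<close>

definition HE_concat :: "nat \<Rightarrow> ((nat \<Rightarrow> real) \<Rightarrow> 'a) \<Rightarrow> ((nat \<Rightarrow> real) \<Rightarrow> 'a) \<Rightarrow> (nat \<Rightarrow> real) \<Rightarrow> 'a" where
  "HE_concat n f g r =
     (case inv_into ({1..} \<times> cube n) (\<lambda>(k, t). sphere_char n k t) r of
        (k, t) \<Rightarrow> cube_concat (f \<circ> sphere_char n k) (g \<circ> sphere_char n k) t)"

definition Hawaiian_group :: "nat \<Rightarrow> 'a topology \<Rightarrow> 'a \<Rightarrow> ((nat \<Rightarrow> real) \<Rightarrow> 'a) set monoid" where
  "Hawaiian_group n X x0 =
     \<lparr>carrier = {HE_class n X x0 f | f. HE_map n X x0 f},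
      monoid.mult = (\<lambda>A B. \<Union>f\<in>A. \<Union>g\<in>B. HE_class n X x0 (HE_concat n f g)),
      one = HE_class n X x0 (\<lambda>_. x0)\<rparr>"

definition Hawaiian_group_induced ::
  "nat \<Rightarrow> 'b topology \<Rightarrow> 'b \<Rightarrow> ('a \<Rightarrow> 'b) \<Rightarrow> ((nat \<Rightarrow> real) \<Rightarrow> 'a) set \<Rightarrow> ((nat \<Rightarrow> real) \<Rightarrow> 'b) set" where
  "Hawaiian_group_induced n Y y0 \<beta> A = (\<Union>f\<in>A. HE_class n Y y0 (\<beta> \<circ> f))"

lemma sphere_char_denominator_pos: "(bump n t)\<^sup>2 + (\<Sum>j<n. (2 * t j - 1)\<^sup>2) > 0"
proof (cases "bump n t = 0")
  case True
  then obtain i where i: "i < n" "(2 * t i - 1)\<^sup>2 = 1"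
    unfolding bump_def by auto
  have "(2 * t i - 1)\<^sup>2 \<le> (\<Sum>j<n. (2 * t j - 1)\<^sup>2)"
    by (rule member_le_sum) (use i(1) in auto)
  then have "(\<Sum>j<n. (2 * t j - 1)\<^sup>2) \<ge> 1" using i(2) by simp
  then show ?thesis by (smt (verit) zero_le_power2)
next
  case False
  have "0 < (bump n t)\<^sup>2" using False by simp
  moreover have "0 \<le> (\<Sum>j<n. (2 * t j - 1)\<^sup>2)" by (intro sum_nonneg) simp
  ultimately show ?thesis by linarith
qed

lemma bump_nonneg:
  assumes "t \<in> cube n"
  shows "0 \<le> bump n t"
  unfolding bump_def
proof (rule prod_nonneg)
  fix i assume "i \<in> {..<n}"
  then have "\<bar>2 * t i - 1\<bar> \<le> 1" using assms by (auto simp: cube_def abs_le_iff)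
  then show "0 \<le> 1 - (2 * t i - 1)\<^sup>2" by (simp add: abs_square_le_1)
qed

lemma bump_eq_0_iff:
  assumes "t \<in> cube n"
  shows "bump n t = 0 \<longleftrightarrow> t \<in> cube_boundary n"
proof -
  have "1 - (2 * x - 1)\<^sup>2 = 0 \<longleftrightarrow> x = 0 \<or> x = 1" for x :: real
    by (simp add: power2_eq_1_iff) auto
  then show ?thesis using assms by (auto simp: bump_def cube_boundary_def)
qed

lemma sphere_char_0: "sphere_char n k t 0
    = 2 / real k * (bump n t)\<^sup>2 / ((bump n t)\<^sup>2 + (\<Sum>j<n. (2 * t j - 1)\<^sup>2))"
  by (simp add: sphere_char_def power2_eq_square)

lemma sphere_char_eq_base_iff:
  assumes "k \<ge> 1"
  shows "sphere_char n k t = HE_base \<longleftrightarrow> bump n t = 0"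
proof
  assume "sphere_char n k t = HE_base"
  then have "sphere_char n k t 0 = 0" by (simp add: HE_base_def)
  with assms sphere_char_denominator_pos[of n t] show "bump n t = 0"
    by (simp add: sphere_char_0)
qed (simp add: sphere_char_def HE_base_def)

lemma sphere_char_in_sphere:
  assumes "k \<ge> 1"
  shows "(sphere_char n k t 0 - 1 / real k)\<^sup>2 + (\<Sum>i=1..n. (sphere_char n k t i)\<^sup>2) = (1 / real k)\<^sup>2"
    and "sphere_char n k t \<in> topspace (Euclidean_space (Suc n))"
proof -
  define b S D c where "b = bump n t" and "S = (\<Sum>j<n. (2 * t j - 1)\<^sup>2)"
    and "D = b\<^sup>2 + S" and "c = 1 / real k"
  have D: "D > 0"
    using sphere_char_denominator_pos[of n t] by (simp add: b_def S_def D_def)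
  have "(\<Sum>i=1..n. (sphere_char n k t i)\<^sup>2) = (\<Sum>j<n. (sphere_char n k t (Suc j))\<^sup>2)"
    by (simp add: sum.atLeast1_atMost_eq)
  also have "\<dots> = (\<Sum>j<n. (2 * c * b / D)\<^sup>2 * (2 * t j - 1)\<^sup>2)"
    by (rule sum.cong) (auto simp: sphere_char_def b_def S_def D_def c_def power_mult_distrib power_divide)
  also have "\<dots> = (2 * c * b / D)\<^sup>2 * S"
    by (simp add: S_def sum_distrib_left)
  finally have 1: "(\<Sum>i=1..n. (sphere_char n k t i)\<^sup>2) = (2 * c * b / D)\<^sup>2 * S" .
  have 0: "sphere_char n k t 0 = 2 * c * b\<^sup>2 / D"
    by (simp add: sphere_char_0 b_def S_def D_def c_def)
  have S: "S = D - b\<^sup>2" by (simp add: D_def)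
  have "(2 * c * b\<^sup>2 / D - c)\<^sup>2 + (2 * c * b / D)\<^sup>2 * (D - b\<^sup>2) = c\<^sup>2"
    using D by (simp add: field_simps power2_eq_square)
  then show "(sphere_char n k t 0 - 1 / real k)\<^sup>2 + (\<Sum>i=1..n. (sphere_char n k t i)\<^sup>2) = (1 / real k)\<^sup>2"
    unfolding 0 1 S c_def .
  show "sphere_char n k t \<in> topspace (Euclidean_space (Suc n))"
    by (auto simp: topspace_Euclidean_space sphere_char_def)
qed

lemma image_sphere_char:
  assumes "n \<ge> 1" and "k \<ge> 1"
  shows "sphere_char n k ` cube n = {r \<in> topspace (Euclidean_space (Suc n)).
           (r 0 - 1 / real k)\<^sup>2 + (\<Sum>i=1..n. (r i)\<^sup>2) = (1 / real k)\<^sup>2}" (is "?L = ?R")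
proof
  show "?L \<subseteq> ?R" using sphere_char_in_sphere[OF assms(2)] by blast
  show "?R \<subseteq> ?L"
  proof
    fix r assume r: "r \<in> ?R"
    define Q where "Q = (\<Sum>i=1..n. (r i)\<^sup>2)"
    have Q0: "Q \<ge> 0" unfolding Q_def by (intro sum_nonneg) simp
    have eq: "(r 0)\<^sup>2 + Q = 2 / real k * r 0"
      using r by (simp add: Q_def power2_diff)
    have rz: "r i = 0" if "i > n" for i
      using r that by (simp add: topspace_Euclidean_space)
    show "r \<in> ?L"
    proof (cases "r 0 = 0")
      case True
      then have "Q = 0" using eq by simp
      then have "r i = 0" if "i \<in> {1..n}" for i
        using that unfolding Q_def by (subst (asm) sum_nonneg_eq_0_iff) auto
      then have "r i = 0" for i
        using True rz[of i] by (cases "i = 0"; cases "i \<le> n") auto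
      then have "r = HE_base" by (auto simp: HE_base_def)
      moreover have "(\<lambda>_. 0) \<in> cube_boundary n"
        using assms(1) by (auto simp: cube_boundary_def cube_def intro!: exI[of _ 0])
      ultimately show ?thesis
        using sphere_char_eq_base_iff[OF assms(2)] bump_eq_0_iff
        by (metis (no_types, lifting) cube_boundary_def image_eqI mem_Collect_eq)
    next
      case False
      define y where "y j = r (Suc j) / r 0" for j
      define M where "M = Max (insert 1 ((\<lambda>j. \<bar>y j\<bar>) ` {..<n}))"
      have M1: "M \<ge> 1" and My: "\<And>j. j < n \<Longrightarrow> \<bar>y j\<bar> \<le> M"
        unfolding M_def by (auto intro!: Max_ge)
      have "M \<in> insert 1 ((\<lambda>j. \<bar>y j\<bar>) ` {..<n})"
        unfolding M_def by (rule Max_in) auto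
      define g where "g s = (\<Prod>j<n. 1 - (s * y j)\<^sup>2) - s" for s
      have le1: "\<bar>s * y j\<bar> \<le> 1" if "0 \<le> s" "s \<le> 1 / M" "j < n" for s j
      proof -
        have "\<bar>s * y j\<bar> \<le> (1 / M) * M"
          unfolding abs_mult using that My[of j] M1 by (intro mult_mono) auto
        then show ?thesis using M1 by simp
      qed
      have gM: "g (1 / M) \<le> 0"
      proof (cases "M = 1")
        case True
        have "(\<Prod>j<n. 1 - (1 / M * y j)\<^sup>2) \<le> 1"
        proof (rule prod_le_1)
          fix j assume "j \<in> {..<n}"
          then have "(1 / M * y j)\<^sup>2 \<le> 1"
            using le1[of "1 / M" j] M1 by (simp only: abs_square_le_1) simp
          then show "0 \<le> 1 - (1 / M * y j)\<^sup>2 \<and> 1 - (1 / M * y j)\<^sup>2 \<le> 1" by simp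
        qed
        then show ?thesis unfolding g_def using True by simp
      next
        case False
        with \<open>M \<in> _\<close> obtain j where j: "j < n" "M = \<bar>y j\<bar>" by auto
        have "(1 / M * y j)\<^sup>2 = 1" using j(2) M1 by (simp add: power_divide)
        then have z: "(\<Prod>j<n. 1 - (1 / M * y j)\<^sup>2) = 0"
          using j(1) by (intro prod_zero) auto
        show ?thesis unfolding g_def z using M1 by simp
      qed
      have "\<exists>s\<ge>0. s \<le> 1 / M \<and> g s = 0"
        using M1 gM by (intro IVT2') (auto simp: g_def intro!: continuous_intros)
      then obtain s where s: "0 \<le> s" "s \<le> 1 / M" "g s = 0" by blast
      have s0: "s \<noteq> 0" using s(3) by (auto simp: g_def)
      define t where "t j = (if j < n then (1 + s * y j) / 2 else 0)" for j
      have u: "2 * t j - 1 = s * y j" if "j < n" for j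
        using that by (simp add: t_def field_simps)
      have t: "t \<in> cube n"
        using le1[OF s(1,2)] by (auto simp: cube_def t_def abs_le_iff) (smt (verit))+
      have b: "bump n t = s"
        using s(3) u by (simp add: bump_def g_def)
      define N where "N = (\<Sum>j<n. (y j)\<^sup>2)"
      have N0: "N \<ge> 0" unfolding N_def by (intro sum_nonneg) simp
      have "(\<Sum>j<n. (2 * t j - 1)\<^sup>2) = (\<Sum>j<n. s\<^sup>2 * (y j)\<^sup>2)"
        by (rule sum.cong) (simp_all add: u power_mult_distrib)
      then have D: "(bump n t)\<^sup>2 + (\<Sum>j<n. (2 * t j - 1)\<^sup>2) = s\<^sup>2 * (1 + N)"
        by (simp add: b N_def sum_distrib_left distrib_left)
      have "Q = (\<Sum>j<n. (r (Suc j))\<^sup>2)"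
        unfolding Q_def by (simp add: sum.atLeast1_atMost_eq)
      also have "\<dots> = (\<Sum>j<n. (r 0)\<^sup>2 * (y j)\<^sup>2)"
        using False by (intro sum.cong) (simp_all add: y_def power_divide)
      finally have "Q = (r 0)\<^sup>2 * N" by (simp add: N_def sum_distrib_left)
      with eq have "r 0 * (r 0 * (1 + N)) = r 0 * (2 / real k)"
        by (simp add: algebra_simps power2_eq_square)
      then have "r 0 * (1 + N) = 2 / real k" using False mult_left_cancel by blast
      then have r0: "2 / real k / (1 + N) = r 0"
        using N0 nonzero_mult_div_cancel_right[of "1 + N" "r 0"] by simp
      have "sphere_char n k t i = r i" for i
      proof -
        have "sphere_char n k t i
            = 2 / real k * s * (if i = 0 then s else if i \<le> n then s * y (i - 1) else 0) / (s\<^sup>2 * (1 + N))"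
          unfolding sphere_char_def D unfolding b using u[of "i - 1"] by auto
        also have "\<dots> = 2 / real k / (1 + N) * (if i = 0 then 1 else if i \<le> n then y (i - 1) else 0)"
          using s0 N0 by (simp add: power2_eq_square)
        also have "\<dots> = r i"
          unfolding r0 using False rz[of i] by (auto simp: y_def)
        finally show ?thesis .
      qed
      then have "sphere_char n k t = r" by auto
      with t show ?thesis by blast
    qed
  qed
qed

lemma sphere_char_inject:
  assumes "k \<ge> 1" "k' \<ge> 1" "t \<in> cube n" "t' \<in> cube n"
    and eq: "sphere_char n k t = sphere_char n k' t'" and ne: "sphere_char n k t \<noteq> HE_base"
  shows "k = k'" and "t = t'"
proof -
  define r where "r = sphere_char n k t"
  have b: "bump n t > 0" "bump n t' > 0"
    using assms bump_nonneg[of t n] bump_nonneg[of t' n] sphere_char_eq_base_iff[of k n t]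
      sphere_char_eq_base_iff[of k' n t'] by (auto simp: less_le)
  have r0: "r 0 \<noteq> 0"
    using b(1) assms(1) sphere_char_denominator_pos[of n t] by (simp add: r_def sphere_char_0)
  have "(r 0)\<^sup>2 + (\<Sum>i=1..n. (r i)\<^sup>2) = 2 / real k * r 0"
    using sphere_char_in_sphere(1)[OF assms(1), of n t] by (simp add: r_def power2_diff)
  moreover have "(r 0)\<^sup>2 + (\<Sum>i=1..n. (r i)\<^sup>2) = 2 / real k' * r 0"
    using sphere_char_in_sphere(1)[OF assms(2), of n t'] by (simp add: r_def eq power2_diff)
  ultimately show "k = k'" using r0 assms(1,2) by simp
  have ratio: "sphere_char n l s (Suc j) / sphere_char n l s 0 = (2 * s j - 1) / bump n s"
    if "l \<ge> 1" "bump n s > 0" "j < n" for l s j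
    using that sphere_char_denominator_pos[of n s]
    by (simp add: sphere_char_def)
  have q: "(2 * t j - 1) / bump n t = (2 * t' j - 1) / bump n t'" if "j < n" for j
    using ratio[OF assms(1) b(1) that] ratio[OF assms(2) b(2) that] eq by simp
  have le: "bump n v \<ge> bump n w"
    if "w \<in> cube n" "bump n v > 0" "bump n w \<ge> bump n v"
      "\<And>j. j < n \<Longrightarrow> (2 * w j - 1) / bump n w = (2 * v j - 1) / bump n v" for v w
    unfolding bump_def
  proof (rule prod_mono)
    fix j assume "j \<in> {..<n}"
    then have j: "j < n" by simp
    have w: "(2 * w j - 1)\<^sup>2 \<le> 1"
      using that(1) j by (auto simp: cube_def abs_square_le_1 abs_le_iff)
    have bw: "bump n w > 0" using that by linarith
    have "2 * v j - 1 = (2 * w j - 1) * (bump n v / bump n w)"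
      using that(2) bw that(4)[OF j] by (simp add: field_simps)
    then have "(2 * v j - 1)\<^sup>2 = (2 * w j - 1)\<^sup>2 * (bump n v / bump n w)\<^sup>2"
      by (simp only: power_mult_distrib)
    also have "\<dots> \<le> (2 * w j - 1)\<^sup>2 * 1"
      using that(2,3) bw by (intro mult_left_mono power_le_one) auto
    finally show "0 \<le> 1 - (2 * w j - 1)\<^sup>2 \<and> 1 - (2 * w j - 1)\<^sup>2 \<le> 1 - (2 * v j - 1)\<^sup>2"
      using w by simp
  qed
  have "bump n t = bump n t'"
    using le[of t t'] le[of t' t] assms(3,4) b q by (metis linear antisym)
  then have "t j = t' j" if "j < n" for j
    using q[OF that] b by simp
  moreover have "t j = t' j" if "\<not> j < n" for j
    using that assms(3,4) by (simp add: cube_def)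
  ultimately show "t = t'" by (intro ext) blast
qed

lemma cube_concat_boundary:
  assumes "n \<ge> 1" and "t \<in> cube_boundary n"
    and "\<And>s. s \<in> cube_boundary n \<Longrightarrow> f s = x0" and "\<And>s. s \<in> cube_boundary n \<Longrightarrow> g s = x0"
  shows "cube_concat f g t = x0"
proof -
  have t: "t \<in> cube n" using assms(2) by (simp add: cube_boundary_def)
  obtain i where i: "i < n" "t i = 0 \<or> t i = 1" using assms(2) by (auto simp: cube_boundary_def)
  have t0: "0 \<le> t 0" "t 0 \<le> 1" using t assms(1) by (auto simp: cube_def)
  have "t(0 := 2 * t 0) \<in> cube_boundary n" if "t 0 \<le> 1/2"
    using t i that t0 assms(1) by (auto simp: cube_boundary_def cube_def intro!: exI[of _ i])
  moreover have "t(0 := 2 * t 0 - 1) \<in> cube_boundary n" if "\<not> t 0 \<le> 1/2"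
    using t i that t0 assms(1) by (auto simp: cube_boundary_def cube_def intro!: exI[of _ i])
  ultimately show ?thesis
    using assms(3,4) by (auto simp: cube_concat_def)
qed

lemma HE_concat_sphere_char:
  assumes "n \<ge> 1" "k \<ge> 1" "t \<in> cube n" and fg: "f HE_base = x0" "g HE_base = x0"
  shows "HE_concat n f g (sphere_char n k t)
           = cube_concat (f \<circ> sphere_char n k) (g \<circ> sphere_char n k) t"
proof -
  let ?F = "\<lambda>(k, t). sphere_char n k t"
  let ?A = "{1..} \<times> cube n"
  obtain l s where ls: "inv_into ?A ?F (sphere_char n k t) = (l, s)" by force
  have im: "sphere_char n k t \<in> ?F ` ?A" using assms(2,3) by force
  have "(l, s) \<in> ?A" using inv_into_into[OF im] ls by simp
  moreover have "?F (l, s) = sphere_char n k t" using f_inv_into_f[OF im] ls by simp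
  ultimately have l: "l \<ge> 1" "s \<in> cube n" "sphere_char n l s = sphere_char n k t" by auto
  have lhs: "HE_concat n f g (sphere_char n k t)
      = cube_concat (f \<circ> sphere_char n l) (g \<circ> sphere_char n l) s"
    unfolding HE_concat_def ls by simp
  show ?thesis
  proof (cases "sphere_char n k t = HE_base")
    case True
    have bd: "(h \<circ> sphere_char n m) w = x0"
      if "m \<ge> 1" "h HE_base = x0" "w \<in> cube_boundary n" for h m w
    proof -
      have "bump n w = 0" using that(3) bump_eq_0_iff[of w n] by (simp add: cube_boundary_def)
      then show ?thesis using that(1,2) sphere_char_eq_base_iff[of m n w] by simp
    qed
    have s: "s \<in> cube_boundary n"
      using True l(3) sphere_char_eq_base_iff[OF l(1), of n s] bump_eq_0_iff[OF l(2)] by simp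
    have t: "t \<in> cube_boundary n"
      using True sphere_char_eq_base_iff[OF assms(2), of n t] bump_eq_0_iff[OF assms(3)] by simp
    have "cube_concat (f \<circ> sphere_char n l) (g \<circ> sphere_char n l) s = x0"
      by (rule cube_concat_boundary[OF assms(1) s bd[of l f, OF l(1) fg(1)] bd[of l g, OF l(1) fg(2)]])
    moreover have "cube_concat (f \<circ> sphere_char n k) (g \<circ> sphere_char n k) t = x0"
      by (rule cube_concat_boundary[OF assms(1) t bd[of k f, OF assms(2) fg(1)] bd[of k g, OF assms(2) fg(2)]])
    ultimately show ?thesis unfolding lhs by (rule trans[OF _ sym])
  next
    case False
    then have "l = k" "s = t"
      using sphere_char_inject[OF l(1) assms(2) l(2) assms(3) l(3)] unfolding l(3) by blast+
    then show ?thesis using lhs by blast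
  qed
qed

end

theory Submission
  imports Defs
begin

text \<open>
  Let \<open>V\<close> be an open neighbourhood of the base point all of whose \<open>n\<close>-spheres are null-homotopic
  in \<open>X\<close>. By continuity a map \<open>f\<close> of the earring sends all but finitely many spheres into \<open>V\<close>. It is
  determined up to homotopy by the classes of its restrictions to the single spheres, almost all
  of which vanish, together with its truncation, which is constant on the first \<open>K - 1\<close> spheres,
  agrees with \<open>f\<close> on the others and takes values in \<open>V\<close> for large \<open>K\<close>. The class of the truncation in \<open>X\<close>
  does not depend on \<open>K\<close>, because the spheres in \<open>V\<close> are null-homotopic. Restriction and truncation
  commute with the operation on the level of maps, so the two components form an isomorphism.
\<close>

text \<open>The base point of the earring is the obstacle. A sphere in \<open>V\<close> contracts
  somewhere in \<open>X\<close>, but the contraction may leave \<open>V\<close>, and contractions of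
  infinitely many small spheres need not shrink with the spheres, so they do not assemble to a
  continuous homotopy. Hence only finitely many spheres are altered at a time, the tail survives as
  a summand of its own, and truncations at different indices are compared on the finitely many
  spheres where they differ. The truncation takes values in \<open>V\<close> but is classified up to
  homotopy in \<open>X\<close>; this is why the image of the inclusion appears and not the Hawaiian
  group of the neighbourhood itself. The two components do not overlap: a map into \<open>V\<close>
  has null-homotopic restrictions, while truncating it at 1 changes nothing. Conversely, finite
  support of the sphere classes is what lets a prescribed pair of components be realised by glueing.
  The splitting concerns an arbitrary pointed space. The wedge enters only because an open
  neighbourhood of its base point is the wedge of its two traces.\<close>

abbreviation cube_homotopic ::
  "nat \<Rightarrow> 'a topology \<Rightarrow> 'a \<Rightarrow> ((nat \<Rightarrow> real) \<Rightarrow> 'a) \<Rightarrow> ((nat \<Rightarrow> real) \<Rightarrow> 'a) \<Rightarrow> bool" where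
  "cube_homotopic n X x0 \<equiv> homotopic_with (\<lambda>h. \<forall>t\<in>cube_boundary n. h t = x0) (cube_top n) X"

abbreviation HE_homotopic ::
  "nat \<Rightarrow> 'a topology \<Rightarrow> 'a \<Rightarrow> ((nat \<Rightarrow> real) \<Rightarrow> 'a) \<Rightarrow> ((nat \<Rightarrow> real) \<Rightarrow> 'a) \<Rightarrow> bool" where
  "HE_homotopic n X x0 \<equiv> homotopic_with (\<lambda>h. h HE_base = x0) (HE_top n) X"

text \<open>Reflexivity at \<open>g\<close> says that \<open>g\<close> is an admissible map, hence a
  member of its own class. Nothing is asked of \<open>f\<close>: either side of the equivalence
  already makes \<open>f\<close> homotopic to \<open>g\<close>.\<close>

lemma homotopic_with_class_eq_iff:
  assumes "homotopic_with P X Y g g"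
  shows "{h. homotopic_with P X Y f h} = {h. homotopic_with P X Y g h} \<longleftrightarrow> homotopic_with P X Y f g"
  using assms by (auto intro: homotopic_with_trans homotopic_with_symD)

text \<open>The group operations are unions over all representatives. Once the resulting class is
  independent of them, the union collapses, because the index sets are nonempty.\<close>

lemma UN_UN_const:
  assumes "a \<in> A" "b \<in> B" "\<And>x y. x \<in> A \<Longrightarrow> y \<in> B \<Longrightarrow> c x y = C"
  shows "(\<Union>x\<in>A. \<Union>y\<in>B. c x y) = C"
proof -
  have "(\<Union>x\<in>A. \<Union>y\<in>B. c x y) = (\<Union>x\<in>A. \<Union>y\<in>B. C)"
    using assms(3) by (intro SUP_cong refl)
  also have "\<dots> = C" using assms(1,2) by auto
  finally show ?thesis .
qed

section \<open>Maps of cubes\<close>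

text \<open>The vanishing of the coordinates from \<open>n\<close> on is already part of
  \<open>cube\<close>. As a subspace of the full product, the cube has continuity tested
  coordinatewise and compactness by Tychonoff, with degenerate factors from index \<open>n\<close>
  on.\<close>

lemma cube_top_alt: "cube_top n = subtopology (powertop_real UNIV) (cube n)"
proof -
  have "{x. \<forall>i\<ge>n. x i = 0} \<inter> cube n = cube n" by (auto simp: cube_def)
  then show ?thesis by (simp add: cube_top_def Euclidean_space_def subtopology_subtopology)
qed

lemma topspace_cube_top [simp]: "topspace (cube_top n) = cube n"
  by (simp add: cube_top_alt)

lemma continuous_map_cube_top:
  "continuous_map Z (cube_top n) f \<longleftrightarrow>
     (\<forall>i. continuous_map Z euclideanreal (\<lambda>z. f z i)) \<and> f \<in> topspace Z \<rightarrow> cube n"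
  by (auto simp: cube_top_alt continuous_map_in_subtopology continuous_map_componentwise_UNIV)

lemma continuous_map_cube_coord:
  "continuous_map Z (cube_top n) f \<Longrightarrow> continuous_map Z euclideanreal (\<lambda>z. f z i)"
  by (simp add: continuous_map_cube_top)

lemma compact_space_cube_top: "compact_space (cube_top n)"
proof -
  have "cube n = PiE UNIV (\<lambda>i. if i < n then {0..1} else {0})"
    by (auto simp: cube_def PiE_iff split: if_splits) 
  moreover have "compactin (powertop_real UNIV) (PiE (UNIV::nat set) (\<lambda>i. if i < n then {0..1} else {0::real}))"
    by (subst compactin_PiE) auto
  ultimately show ?thesis
    unfolding cube_top_alt by (simp add: compactin_subspace)
qed

lemma cube_boundary_subset: "cube_boundary n \<subseteq> cube n"
  by (auto simp: cube_boundary_def)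

lemma cube_coord_in: "t \<in> cube n \<Longrightarrow> n \<ge> 1 \<Longrightarrow> 0 \<le> t 0 \<and> t 0 \<le> 1"
  by (auto simp: cube_def)

lemma cube_upd: "t \<in> cube n \<Longrightarrow> n \<ge> 1 \<Longrightarrow> 0 \<le> x \<Longrightarrow> x \<le> 1 \<Longrightarrow> t(0 := x) \<in> cube n"
  by (auto simp: cube_def)

lemma cube_boundary_upd: "t \<in> cube n \<Longrightarrow> n \<ge> 1 \<Longrightarrow> x = 0 \<or> x = 1 \<Longrightarrow> t(0 := x) \<in> cube_boundary n"
  by (auto simp: cube_def cube_boundary_def intro!: exI[of _ 0])

lemma cube_homotopic_iff:
  "cube_homotopic n X x0 f g \<longleftrightarrow>
     (\<exists>H. continuous_map (prod_topology (top_of_set {0..1::real}) (cube_top n)) X H \<and>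
        (\<forall>t\<in>cube n. H (0, t) = f t) \<and> (\<forall>t\<in>cube n. H (1, t) = g t) \<and>
        (\<forall>s\<in>{0..1}. \<forall>t\<in>cube_boundary n. H (s, t) = x0))"
proof -
  have "homotopic_with (\<lambda>h. \<forall>t\<in>cube_boundary n. h t = x0) (cube_top n) X f g \<longleftrightarrow>
     (\<exists>H. continuous_map (prod_topology (top_of_set {0..1::real}) (cube_top n)) X H \<and>
        (\<forall>t\<in>topspace (cube_top n). H (0, t) = f t) \<and> (\<forall>t\<in>topspace (cube_top n). H (1, t) = g t) \<and>
        (\<forall>s\<in>{0..1}. \<forall>t\<in>cube_boundary n. H (s, t) = x0))"
    by (rule homotopic_with) (use cube_boundary_subset in force)
  then show ?thesis by simp
qed

text \<open>Reading admissibility as self-homotopy turns each statement about homotopies into one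
  about maps, so closure properties need no separate proof.\<close>

lemma cube_map_iff: "cube_map n X x0 f \<longleftrightarrow> cube_homotopic n X x0 f f"
  by (simp add: cube_map_def)

lemma cube_homotopic_imp_map:
  assumes "cube_homotopic n X x0 f g"
  shows "cube_map n X x0 f" and "cube_map n X x0 g"
  using homotopic_with_imp_continuous_maps[OF assms] homotopic_with_imp_property[OF assms]
  by (simp_all add: cube_map_def)

lemma cube_homotopic_cong:
  assumes "cube_homotopic n X x0 f g"
    and "\<And>t. t \<in> cube n \<Longrightarrow> f' t = f t" "\<And>t. t \<in> cube n \<Longrightarrow> g' t = g t"
  shows "cube_homotopic n X x0 f' g'"
  using assms by (simp add: cube_homotopic_iff)

lemma cube_class_eq_iff:
  "cube_map n X x0 g \<Longrightarrow> cube_class n X x0 f = cube_class n X x0 g \<longleftrightarrow> cube_homotopic n X x0 f g"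
  unfolding cube_class_def by (rule homotopic_with_class_eq_iff) (simp only: cube_map_iff)

text \<open>On the seam, where coordinate 0 is 1/2, both halves are evaluated on a face of the cube
  and give \<open>x0\<close>. The parameter space \<open>Z\<close> is left open: the interval yields
  homotopies of cubes, the interval times the scales yields homotopies on the earring.\<close>

lemma continuous_map_cube_concat:
  assumes n: "n \<ge> 1"
    and F: "continuous_map (prod_topology Z (cube_top n)) X F"
    and G: "continuous_map (prod_topology Z (cube_top n)) X G"
    and F0: "\<And>z t. z \<in> topspace Z \<Longrightarrow> t \<in> cube_boundary n \<Longrightarrow> F (z, t) = x0"
    and G0: "\<And>z t. z \<in> topspace Z \<Longrightarrow> t \<in> cube_boundary n \<Longrightarrow> G (z, t) = x0"
  shows "continuous_map (prod_topology Z (cube_top n)) X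
           (\<lambda>(z, t). cube_concat (\<lambda>t. F (z, t)) (\<lambda>t. G (z, t)) t)"
proof -
  let ?W = "prod_topology Z (cube_top n)"
  have c: "continuous_map (subtopology ?W S) euclideanreal (\<lambda>w. snd w i)" for i S
    using continuous_map_cube_coord[OF continuous_map_snd]
    by (blast intro: continuous_map_from_subtopology)
  have c0: "continuous_map ?W euclideanreal (\<lambda>w. snd w 0)"
    using continuous_map_cube_coord[OF continuous_map_snd] by blast
  \<comment> \<open>One affine substitution serves both halves, with \<open>a = 2\<close> and
    \<open>b = 0\<close> or \<open>b = -1\<close>. Restricting to \<open>S\<close> keeps the new
    coordinate in the unit interval.\<close>
  have upd: "continuous_map (subtopology ?W S) ?W (\<lambda>w. (fst w, (snd w)(0 := a * snd w 0 + b)))"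
    if "\<And>w. w \<in> topspace ?W \<inter> S \<Longrightarrow> 0 \<le> a * snd w 0 + b \<and> a * snd w 0 + b \<le> 1" for a b S
    unfolding continuous_map_paired continuous_map_cube_top
  proof (intro conjI allI)
    show "continuous_map (subtopology ?W S) euclideanreal (\<lambda>w. ((snd w)(0 := a * snd w 0 + b)) i)" for i
      by (cases "i = 0") (auto intro!: continuous_intros c)
  qed (use that n in \<open>auto intro!: cube_upd continuous_map_from_subtopology continuous_map_fst\<close>)
  have "continuous_map ?W X (\<lambda>w. if snd w 0 \<le> 1/2 then F (fst w, (snd w)(0 := 2 * snd w 0))
          else G (fst w, (snd w)(0 := 2 * snd w 0 - 1)))"
  proof (rule continuous_map_cases_le)
    let ?S = "{w \<in> topspace ?W. snd w 0 \<le> 1/2}"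
    have "continuous_map (subtopology ?W ?S) X (F \<circ> (\<lambda>w. (fst w, (snd w)(0 := 2 * snd w 0 + 0))))"
      by (rule continuous_map_compose[OF upd F]) (use n cube_coord_in in force)
    then show "continuous_map (subtopology ?W ?S) X (\<lambda>w. F (fst w, (snd w)(0 := 2 * snd w 0)))"
      by (simp add: o_def)
    let ?S = "{w \<in> topspace ?W. 1/2 \<le> snd w 0}"
    have "continuous_map (subtopology ?W ?S) X (G \<circ> (\<lambda>w. (fst w, (snd w)(0 := 2 * snd w 0 + -1))))"
      by (rule continuous_map_compose[OF upd G]) (use n cube_coord_in in force)
    then show "continuous_map (subtopology ?W ?S) X (\<lambda>w. G (fst w, (snd w)(0 := 2 * snd w 0 - 1)))"
      by (simp add: o_def)
  qed (use c0 n F0 G0 in \<open>auto simp: cube_boundary_upd\<close>)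
  then show ?thesis
    by (simp add: cube_concat_def case_prod_unfold)
qed

lemma cube_homotopic_concat:
  assumes n: "n \<ge> 1" and f: "cube_homotopic n X x0 f f'" and g: "cube_homotopic n X x0 g g'"
  shows "cube_homotopic n X x0 (cube_concat f g) (cube_concat f' g')"
proof -
  obtain F where F: "continuous_map (prod_topology (top_of_set {0..1::real}) (cube_top n)) X F"
    "\<forall>t\<in>cube n. F (0, t) = f t" "\<forall>t\<in>cube n. F (1, t) = f' t"
    "\<forall>s\<in>{0..1}. \<forall>t\<in>cube_boundary n. F (s, t) = x0"
    using f unfolding cube_homotopic_iff by blast
  obtain G where G: "continuous_map (prod_topology (top_of_set {0..1::real}) (cube_top n)) X G"
    "\<forall>t\<in>cube n. G (0, t) = g t" "\<forall>t\<in>cube n. G (1, t) = g' t"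
    "\<forall>s\<in>{0..1}. \<forall>t\<in>cube_boundary n. G (s, t) = x0"
    using g unfolding cube_homotopic_iff by blast
  let ?H = "\<lambda>(s, t). cube_concat (\<lambda>t. F (s, t)) (\<lambda>t. G (s, t)) t"
  have in_cube: "t(0 := 2 * t 0) \<in> cube n" if "t \<in> cube n" "t 0 \<le> 1/2" for t
    using that n cube_coord_in[OF that(1) n] by (auto intro!: cube_upd)
  have in_cube': "t(0 := 2 * t 0 - 1) \<in> cube n" if "t \<in> cube n" "\<not> t 0 \<le> 1/2" for t
    using that n cube_coord_in[OF that(1) n] by (auto intro!: cube_upd)
  show ?thesis
    unfolding cube_homotopic_iff
  proof (intro exI[of _ ?H] conjI ballI)
    show "continuous_map (prod_topology (top_of_set {0..1::real}) (cube_top n)) X ?H"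
      by (rule continuous_map_cube_concat[OF n F(1) G(1)]) (use F(4) G(4) in auto)
    show "?H (s, t) = x0" if "s \<in> {0..1}" "t \<in> cube_boundary n" for s t
      using cube_concat_boundary[OF n that(2), of "\<lambda>t. F (s, t)" x0 "\<lambda>t. G (s, t)"] F(4) G(4) that
      by simp
  qed (use in_cube in_cube' F G in \<open>auto simp: cube_concat_def\<close>)
qed

text \<open>The straight-line homotopy from \<open>\<sigma>\<close> to \<open>\<tau>\<close> stays
  in the interval by convexity. The common end values keep two opposite faces on the boundary; they
  may coincide, which is what the inverse law uses.\<close>

lemma cube_homotopic_reparam:
  assumes n: "n \<ge> 1" and f: "cube_map n X x0 f"
    and \<sigma>: "continuous_on {0..1} \<sigma>" "\<sigma> \<in> {0..1} \<rightarrow> {0..1::real}"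
    and \<tau>: "continuous_on {0..1} \<tau>" "\<tau> \<in> {0..1} \<rightarrow> {0..1}"
    and ends: "\<sigma> 0 = \<tau> 0" "\<sigma> 1 = \<tau> 1" "\<sigma> 0 \<in> {0, 1}" "\<sigma> 1 \<in> {0, 1}"
  shows "cube_homotopic n X x0 (\<lambda>t. f (t(0 := \<sigma> (t 0)))) (\<lambda>t. f (t(0 := \<tau> (t 0))))"
proof -
  let ?W = "prod_topology (top_of_set {0..1::real}) (cube_top n)"
  let ?m = "\<lambda>w::real \<times> (nat \<Rightarrow> real). (1 - fst w) * \<sigma> (snd w 0) + fst w * \<tau> (snd w 0)"
  let ?H = "\<lambda>w. f ((snd w)(0 := ?m w))"
  have c: "continuous_map ?W euclideanreal (\<lambda>w. snd w i)" for i
    using continuous_map_cube_coord[OF continuous_map_snd] by blast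
  have c1: "continuous_map ?W euclideanreal fst"
    by (rule continuous_map_into_fulltopology[OF continuous_map_fst])
  have c0: "continuous_map ?W (top_of_set {0..1::real}) (\<lambda>w. snd w 0)"
    using c[of 0] cube_coord_in[OF _ n] by (auto simp: continuous_map_in_subtopology)
  have comp: "continuous_map ?W euclideanreal (\<lambda>w. \<rho> (snd w 0))" if "continuous_on {0..1} \<rho>" for \<rho> :: "real \<Rightarrow> real"
    using continuous_map_compose[OF c0, of euclideanreal \<rho>] that by (simp add: o_def)
  have m: "0 \<le> ?m w \<and> ?m w \<le> 1" if "w \<in> topspace ?W" for w
  proof -
    have t: "snd w 0 \<in> {0..1}" and s: "fst w \<in> {0..1}"
      using that cube_coord_in[OF _ n] by (auto simp: case_prod_unfold)
    then have "\<sigma> (snd w 0) \<in> {0..1}" "\<tau> (snd w 0) \<in> {0..1}" using \<sigma>(2) \<tau>(2) by auto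
    then show ?thesis using s convex_bound_le[of "\<sigma> (snd w 0)" 1 "\<tau> (snd w 0)" "1 - fst w" "fst w"] by auto
  qed
  have "continuous_map ?W (cube_top n) (\<lambda>w. (snd w)(0 := ?m w))"
    unfolding continuous_map_cube_top
  proof (intro conjI allI)
    show "continuous_map ?W euclideanreal (\<lambda>w. ((snd w)(0 := ?m w)) i)" for i
      by (cases "i = 0") (auto intro!: continuous_intros c c1 comp \<sigma> \<tau>)
  qed (use m n in \<open>auto intro!: cube_upd\<close>)
  then have "continuous_map ?W X ?H"
    using continuous_map_compose[of ?W "cube_top n" "\<lambda>w. (snd w)(0 := ?m w)" X f] f
    by (simp add: cube_map_def o_def)
  moreover have "?H (s, t) = x0" if s: "s \<in> {0..1}" and t: "t \<in> cube_boundary n" for s t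
  proof -
    have tc: "t \<in> cube n" using t cube_boundary_subset by blast
    obtain i where i: "i < n" "t i = 0 \<or> t i = 1" using t by (auto simp: cube_boundary_def)
    \<comment> \<open>If coordinate 0 is the extreme one, the interpolation is frozen at a common
      end value; otherwise the extreme coordinate is left alone.\<close>
    have "t(0 := ?m (s, t)) \<in> cube_boundary n"
    proof (cases "i = 0")
      case True
      then have "?m (s, t) = \<sigma> (t 0)" using i ends(1,2) by (auto simp: algebra_simps)
      moreover have "\<sigma> (t 0) = 0 \<or> \<sigma> (t 0) = 1" using i(2) ends(3,4) True by (elim disjE) auto
      ultimately show ?thesis by (simp only: cube_boundary_upd[OF tc n])
    next
      case False
      have "t(0 := ?m (s, t)) \<in> cube n"
        using m[of "(s, t)"] s tc n by (intro cube_upd) auto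
      moreover have "(t(0 := ?m (s, t))) i = t i" using False by simp
      ultimately show ?thesis using i unfolding cube_boundary_def by (intro CollectI conjI exI[of _ i]) simp_all
    qed
    then show ?thesis using f by (simp add: cube_map_def)
  qed
  ultimately show ?thesis
    unfolding cube_homotopic_iff by (intro exI[of _ ?H]) simp
qed

lemma cube_map_const: "x0 \<in> topspace X \<Longrightarrow> cube_map n X x0 (\<lambda>_. x0)"
  by (simp add: cube_map_def)

lemma cube_map_concat:
  "n \<ge> 1 \<Longrightarrow> cube_map n X x0 f \<Longrightarrow> cube_map n X x0 g \<Longrightarrow> cube_map n X x0 (cube_concat f g)"
  using cube_homotopic_concat[of n x0 X f f g g] by (simp only: cube_map_iff)

lemma mult_homotopy_group:
  assumes n: "n \<ge> 1" and f: "cube_map n X x0 f" and g: "cube_map n X x0 g"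
  shows "cube_class n X x0 f \<otimes>\<^bsub>homotopy_group n X x0\<^esub> cube_class n X x0 g
           = cube_class n X x0 (cube_concat f g)"
proof -
  have "cube_class n X x0 (cube_concat f' g') = cube_class n X x0 (cube_concat f g)"
    if "f' \<in> cube_class n X x0 f" "g' \<in> cube_class n X x0 g" for f' g'
  proof -
    have "cube_homotopic n X x0 f f'" "cube_homotopic n X x0 g g'"
      using that by (simp_all add: cube_class_def)
    then have "cube_homotopic n X x0 (cube_concat f' g') (cube_concat f g)"
      by (rule homotopic_with_symD[OF cube_homotopic_concat[OF n]])
    then show ?thesis
      by (simp only: cube_class_eq_iff[OF cube_homotopic_imp_map(2)])
  qed
  moreover have "f \<in> cube_class n X x0 f" "g \<in> cube_class n X x0 g"
    using f g by (simp_all add: cube_class_def cube_map_def)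
  ultimately show ?thesis
    unfolding homotopy_group_def monoid.simps by (intro UN_UN_const)
qed

text \<open>Each axiom compares two reparametrisations of one cube map in coordinate 0. The result
  is needed to describe the carrier of the direct sum, whose summands must be groups.\<close>

lemma group_homotopy_group:
  assumes n: "n \<ge> 1" and x0: "x0 \<in> topspace X"
  shows "group (homotopy_group n X x0)" (is "group ?G")
proof (rule groupI)
  have carr: "A \<in> carrier ?G \<longleftrightarrow> (\<exists>f. A = cube_class n X x0 f \<and> cube_map n X x0 f)" for A
    by (auto simp: homotopy_group_def)
  have one: "\<one>\<^bsub>?G\<^esub> = cube_class n X x0 (\<lambda>_. x0)" by (simp add: homotopy_group_def)
  note mult = mult_homotopy_group[OF n]
  note const = cube_map_const[OF x0]
  show "\<one>\<^bsub>?G\<^esub> \<in> carrier ?G" using one const carr by blast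
  show "A \<otimes>\<^bsub>?G\<^esub> B \<in> carrier ?G" if "A \<in> carrier ?G" "B \<in> carrier ?G" for A B
    using that unfolding carr by (metis mult cube_map_concat[OF n])
  show "A \<otimes>\<^bsub>?G\<^esub> B \<otimes>\<^bsub>?G\<^esub> C = A \<otimes>\<^bsub>?G\<^esub> (B \<otimes>\<^bsub>?G\<^esub> C)"
    if carr_ABC: "A \<in> carrier ?G" "B \<in> carrier ?G" "C \<in> carrier ?G" for A B C
  proof -
    obtain f g h where fgh: "cube_map n X x0 f" "cube_map n X x0 g" "cube_map n X x0 h"
      and ABC: "A = cube_class n X x0 f" "B = cube_class n X x0 g" "C = cube_class n X x0 h"
      using carr_ABC unfolding carr by blast
    let ?c = "cube_concat f (cube_concat g h)"
    \<comment> \<open>The piecewise linear change of coordinate that takes the breakpoints 1/4 and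
      1/2 of one bracketing to the breakpoints 1/2 and 3/4 of the other. Its slopes 2, 1, 1/2
      decrease, so it is a minimum of three affine functions.\<close>
    let ?\<sigma> = "\<lambda>x::real. min (2 * x) (min (x + 1/4) ((x + 1) / 2))"
    have c: "cube_map n X x0 ?c" by (intro cube_map_concat n fgh)
    have "cube_homotopic n X x0 (\<lambda>t. ?c (t(0 := ?\<sigma> (t 0)))) (\<lambda>t. ?c (t(0 := t 0)))"
      by (rule cube_homotopic_reparam[OF n c]) (auto intro!: continuous_intros simp: min_le_iff_disj)
    then have "cube_homotopic n X x0 (cube_concat (cube_concat f g) h) ?c"
    proof (rule cube_homotopic_cong)
      fix t assume "t \<in> cube n"
      consider "t 0 \<le> 1/4" | "1/4 < t 0" "t 0 \<le> 1/2" | "1/2 < t 0" by linarith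
      then show "cube_concat (cube_concat f g) h t = ?c (t(0 := ?\<sigma> (t 0)))"
      proof cases
        case 1
        then have "?\<sigma> (t 0) = 2 * t 0" by (simp add: min_def)
        with 1 show ?thesis by (simp add: cube_concat_def)
      next
        case 2
        then have "?\<sigma> (t 0) = t 0 + 1/4" by (simp add: min_def)
        with 2 show ?thesis by (simp add: cube_concat_def algebra_simps)
      next
        case 3
        then have "?\<sigma> (t 0) = t 0 / 2 + 1/2" by (simp add: min_def add_divide_distrib)
        with 3 show ?thesis
          by (simp add: cube_concat_def) (rule arg_cong[where f = "\<lambda>x. h (t(0 := x))"], simp add: field_simps)
      qed
    qed auto
    then show ?thesis
      unfolding ABC by (simp add: mult fgh cube_map_concat[OF n] cube_class_eq_iff)
  qed
  show "\<one>\<^bsub>?G\<^esub> \<otimes>\<^bsub>?G\<^esub> A = A" if carr_A: "A \<in> carrier ?G" for A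
  proof -
    obtain f where f: "cube_map n X x0 f" and A: "A = cube_class n X x0 f"
      using carr_A unfolding carr by blast
    \<comment> \<open>This reparametrisation waits at 0 during the first half, where
      \<open>f\<close> equals \<open>x0\<close>, and then runs through the interval at double
      speed.\<close>
    have "cube_homotopic n X x0 (\<lambda>t. f (t(0 := max 0 (2 * t 0 - 1)))) (\<lambda>t. f (t(0 := t 0)))"
      by (rule cube_homotopic_reparam[OF n f]) (auto intro!: continuous_intros)
    then have "cube_homotopic n X x0 (cube_concat (\<lambda>_. x0) f) f"
      by (rule cube_homotopic_cong)
        (use cube_boundary_upd[OF _ n] f in \<open>auto simp: cube_concat_def cube_map_def max_def\<close>)
    then show ?thesis
      unfolding A one by (simp add: mult f const cube_class_eq_iff)
  qed
  show "\<exists>B\<in>carrier ?G. B \<otimes>\<^bsub>?G\<^esub> A = \<one>\<^bsub>?G\<^esub>" if carr_A: "A \<in> carrier ?G" for A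
  proof -
    obtain f where f: "cube_map n X x0 f" and A: "A = cube_class n X x0 f"
      using carr_A unfolding carr by blast
    let ?g = "\<lambda>t. f (t(0 := 1 - t 0))"
    have "cube_homotopic n X x0 ?g ?g"
      by (rule cube_homotopic_reparam[OF n f]) (auto intro!: continuous_intros)
    then have g: "cube_map n X x0 ?g" by (rule cube_homotopic_imp_map)
    \<comment> \<open>The concatenation of the reversed map with \<open>f\<close> runs from 1 to 0
      and back. Both ends are 1, so it deforms to the reparametrisation that stays at 1, where
      \<open>f\<close> equals \<open>x0\<close>.\<close>
    have "cube_homotopic n X x0 (\<lambda>t. f (t(0 := \<bar>2 * t 0 - 1\<bar>))) (\<lambda>t. f (t(0 := 1)))"
      by (rule cube_homotopic_reparam[OF n f]) (auto intro!: continuous_intros)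
    then have "cube_homotopic n X x0 (cube_concat ?g f) (\<lambda>_. x0)"
      by (rule cube_homotopic_cong)
        (use cube_boundary_upd[OF _ n] f in \<open>auto simp: cube_concat_def cube_map_def abs_if\<close>)
    then have "cube_class n X x0 ?g \<otimes>\<^bsub>?G\<^esub> A = \<one>\<^bsub>?G\<^esub>"
      unfolding A one by (simp add: mult f g const cube_class_eq_iff)
    then show ?thesis using g carr by blast
  qed
qed

section \<open>The Hawaiian earring as a quotient\<close>

text \<open>The radii together with their limit. Adding 0 makes the parameter space compact, which a
  disjoint union of infinitely many cubes would not be.\<close>

definition HE_scales :: "real set" where
  "HE_scales = insert 0 (range (\<lambda>k. 1 / real (Suc k)))"

text \<open>All spheres are multiples of the unit one, so their parametrisations form a single
  family in the radius \<open>c\<close>, extended to \<open>c = 0\<close> by the constant map to the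
  base point.\<close>

definition HE_param :: "nat \<Rightarrow> real \<Rightarrow> (nat \<Rightarrow> real) \<Rightarrow> nat \<Rightarrow> real" where
  "HE_param n c t = (\<lambda>i. c * sphere_char n 1 t i)"

lemma compact_HE_scales: "compact HE_scales"
proof -
  have "(\<lambda>k. 1 / real (Suc k)) \<longlonglongrightarrow> 0"
    using LIMSEQ_inverse_real_of_nat by (simp add: inverse_eq_divide)
  then show ?thesis unfolding HE_scales_def by (rule compact_sequence_with_limit)
qed

lemma HE_scales_cases:
  assumes "c \<in> HE_scales"
  obtains "c = 0" | k where "k \<ge> 1" "c = 1 / real k"
proof -
  consider "c = 0" | k where "c = 1 / real (Suc k)"
    using assms unfolding HE_scales_def by blast
  then show ?thesis
    by cases (use that(1) that(2)[of "Suc _"] in simp_all)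
qed

lemma inverse_in_HE_scales: "k \<ge> 1 \<Longrightarrow> 1 / real k \<in> HE_scales"
  by (cases k) (auto simp: HE_scales_def)

lemma openin_HE_scales_singleton:
  assumes "k \<ge> 1"
  shows "openin (top_of_set HE_scales) {1 / real k}"
proof -
  \<comment> \<open>This says that \<open>c\<close> lies strictly between \<open>1 / (k + 1)\<close>
    and \<open>1 / (k - 1)\<close>. With denominators cleared, the second bound is void for
    \<open>k = 1\<close> and no case split is needed.\<close>
  have "open {c::real. 1 < c * (real k + 1) \<and> c * (real k - 1) < 1}"
    by (intro open_Collect_conj open_Collect_less continuous_intros)
  moreover have "{1 / real k} = HE_scales \<inter> {c. 1 < c * (real k + 1) \<and> c * (real k - 1) < 1}"
  proof (intro equalityI subsetI)
    fix c assume c: "c \<in> HE_scales \<inter> {c. 1 < c * (real k + 1) \<and> c * (real k - 1) < 1}"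
    then have "c \<in> HE_scales" by simp
    then show "c \<in> {1 / real k}"
    proof (cases rule: HE_scales_cases)
      case (2 m)
      then have "1 < (real k + 1) / real m" "(real k - 1) / real m < 1" using c by simp_all
      then have "real m < real k + 1" "real k - 1 < real m" using 2(1) by (simp_all add: field_simps)
      then have "m = k" by linarith
      then show ?thesis using 2 by simp
    qed (use c in simp)
  next
    fix c :: real assume "c \<in> {1 / real k}"
    then have "c = 1 / real k" by simp
    then show "c \<in> HE_scales \<inter> {c. 1 < c * (real k + 1) \<and> c * (real k - 1) < 1}"
      using assms inverse_in_HE_scales[OF assms] by (simp add: less_divide_eq divide_less_eq)
  qed
  ultimately show ?thesis by (auto simp: openin_open)
qed

lemma HE_param_inverse: "k \<ge> 1 \<Longrightarrow> HE_param n (1 / real k) t = sphere_char n k t"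
  by (auto simp: HE_param_def sphere_char_def)

lemma HE_param_0: "HE_param n 0 t = HE_base"
  by (simp add: HE_param_def HE_base_def)

lemma sphere_char_boundary: "k \<ge> 1 \<Longrightarrow> t \<in> cube_boundary n \<Longrightarrow> sphere_char n k t = HE_base"
  using bump_eq_0_iff[of t n] by (simp add: sphere_char_eq_base_iff cube_boundary_def)

lemma HE_param_boundary: "t \<in> cube_boundary n \<Longrightarrow> HE_param n c t = HE_base"
  using sphere_char_boundary[of 1 t n] by (simp add: HE_param_def HE_base_def)

lemma zero_in_cube_boundary: "n \<ge> 1 \<Longrightarrow> (\<lambda>_. 0) \<in> cube_boundary n"
  by (auto simp: cube_boundary_def cube_def intro!: exI[of _ 0])

lemma HE_eq: "n \<ge> 1 \<Longrightarrow> HE n = (\<Union>k\<in>{1..}. sphere_char n k ` cube n)"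
  by (auto simp: HE_def image_sphere_char)

lemma HE_cases:
  assumes "n \<ge> 1" "r \<in> HE n"
  obtains k t where "k \<ge> 1" "t \<in> cube n" "r = sphere_char n k t"
  using assms by (auto simp: HE_eq)

lemma sphere_char_in_HE: "n \<ge> 1 \<Longrightarrow> k \<ge> 1 \<Longrightarrow> t \<in> cube n \<Longrightarrow> sphere_char n k t \<in> HE n"
  by (auto simp: HE_eq)

lemma HE_base_in_HE: "n \<ge> 1 \<Longrightarrow> HE_base \<in> HE n"
  using sphere_char_in_HE[of n 1] sphere_char_boundary[of 1] zero_in_cube_boundary[of n] cube_boundary_subset
  by (metis order_refl subsetD)

lemma HE_param_in_HE: "n \<ge> 1 \<Longrightarrow> c \<in> HE_scales \<Longrightarrow> t \<in> cube n \<Longrightarrow> HE_param n c t \<in> HE n"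
  by (erule HE_scales_cases) (simp_all add: HE_param_0 HE_base_in_HE HE_param_inverse sphere_char_in_HE)

lemma HE_top_alt: "HE_top n = subtopology (powertop_real UNIV) (HE n)"
proof -
  have "{x. \<forall>i\<ge>Suc n. x i = 0} \<inter> HE n = HE n" by (auto simp: HE_def topspace_Euclidean_space)
  then show ?thesis by (simp add: HE_top_def Euclidean_space_def subtopology_subtopology)
qed

lemma topspace_HE_top [simp]: "topspace (HE_top n) = HE n"
  by (simp add: HE_top_alt)

lemma Hausdorff_space_HE_top: "Hausdorff_space (HE_top n)"
  unfolding HE_top_alt
  by (rule Hausdorff_space_subtopology) (metis Hausdorff_space_euclidean Hausdorff_space_product_topology)

text \<open>The scale occurs only as a factor, so nothing special happens at 0. The one non-constant
  denominator is that of the stereographic formula, which is positive everywhere.\<close>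

lemma continuous_map_HE_param:
  assumes n: "n \<ge> 1"
  shows "continuous_map (prod_topology (top_of_set HE_scales) (cube_top n)) (HE_top n)
           (\<lambda>w. HE_param n (fst w) (snd w))"
proof -
  let ?W = "prod_topology (top_of_set HE_scales) (cube_top n)"
  have c: "continuous_map ?W euclideanreal (\<lambda>w. snd w i)" for i
    using continuous_map_cube_coord[OF continuous_map_snd] by blast
  have c1: "continuous_map ?W euclideanreal fst"
    by (rule continuous_map_into_fulltopology[OF continuous_map_fst])
  have b: "continuous_map ?W euclideanreal (\<lambda>w. bump n (snd w))"
    unfolding bump_def by (intro continuous_intros c) auto
  have d: "(bump n t)\<^sup>2 + (\<Sum>j<n. (2 * t j - 1)\<^sup>2) \<noteq> 0" for t
    using sphere_char_denominator_pos[of n t] by simp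
  have num: "continuous_map ?W euclideanreal
      (\<lambda>w. if i = 0 then bump n (snd w) else if i \<le> n then 2 * snd w (i - 1) - 1 else 0)" for i
    by (cases "i = 0"; cases "i \<le> n") (auto intro!: continuous_intros b c)
  have den: "continuous_map ?W euclideanreal (\<lambda>w. (bump n (snd w))\<^sup>2 + (\<Sum>j<n. (2 * snd w j - 1)\<^sup>2))"
    by (intro continuous_intros b c) auto
  have const: "continuous_map ?W euclideanreal (\<lambda>w. 2 / real 1)" by simp
  have "continuous_map ?W euclideanreal (\<lambda>w. HE_param n (fst w) (snd w) i)" for i
    unfolding HE_param_def sphere_char_def
    by (intro continuous_map_real_mult continuous_map_real_divide c1 b num den const d)
  then show ?thesis
    using HE_param_in_HE[OF n]
    by (auto simp: HE_top_alt continuous_map_in_subtopology continuous_map_componentwise_UNIV)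
qed

text \<open>
  A continuous surjection from a compact space onto a Hausdorff space is a quotient map, so
  homotopies of maps of the earring may be constructed upstairs, where no convergence at the
  base point has to be checked.
\<close>

lemma quotient_map_HE_param:
  assumes n: "n \<ge> 1" and Z: "compact_space Z" "Hausdorff_space Z"
  shows "quotient_map (prod_topology (prod_topology Z (top_of_set HE_scales)) (cube_top n))
           (prod_topology Z (HE_top n)) (\<lambda>((z, c), t). (z, HE_param n c t))"
    (is "quotient_map ?W ?Y ?q")
proof (rule continuous_closed_imp_quotient_map)
  have f: "continuous_map ?W Z (\<lambda>w. fst (fst w))"
    using continuous_map_compose[OF continuous_map_fst continuous_map_fst] by (simp add: o_def)
  have p: "continuous_map ?W (prod_topology (top_of_set HE_scales) (cube_top n)) (\<lambda>w. (snd (fst w), snd w))"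
    using continuous_map_compose[OF continuous_map_fst continuous_map_snd] 
    by (intro continuous_map_pairedI continuous_map_snd) (simp add: o_def)
  have "continuous_map ?W (HE_top n) (\<lambda>w. HE_param n (snd (fst w)) (snd w))"
    using continuous_map_compose[OF p continuous_map_HE_param[OF n]] by (simp add: o_def)
  then show cont: "continuous_map ?W ?Y ?q"
    using f by (simp add: case_prod_unfold continuous_map_pairedI)
  have "compact_space (top_of_set HE_scales)"
    using compact_HE_scales by (simp add: compact_space_subtopology)
  then have "compact_space ?W"
    using Z compact_space_cube_top by (simp add: compact_space_prod_topology)
  moreover have "Hausdorff_space ?Y"
    using Z Hausdorff_space_HE_top by (simp add: Hausdorff_space_prod_topology)
  ultimately show "closed_map ?W ?Y ?q"
    using cont by (intro continuous_imp_closed_map_gen Hausdorff_imp_kc_space)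
  show "?q ` topspace ?W = topspace ?Y"
  proof (intro equalityI subsetI)
    fix y assume "y \<in> topspace ?Y"
    then obtain z r where y: "y = (z, r)" "z \<in> topspace Z" "r \<in> HE n" by auto
    obtain k t where "k \<ge> 1" "t \<in> cube n" "r = sphere_char n k t"
      using HE_cases[OF n y(3)] .
    then show "y \<in> ?q ` topspace ?W"
      using y inverse_in_HE_scales[of k] HE_param_inverse[of k n t]
      by (intro image_eqI[of _ _ "((z, 1 / real k), t)"]) auto
  qed (use HE_param_in_HE[OF n] in auto)
qed

section \<open>Homotopies on the earring and on its parameter space\<close>

lemma HE_homotopic_iff:
  assumes n: "n \<ge> 1"
  shows "HE_homotopic n X x0 f g \<longleftrightarrow>
     (\<exists>H. continuous_map (prod_topology (top_of_set {0..1::real}) (HE_top n)) X H \<and>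
        (\<forall>r\<in>HE n. H (0, r) = f r) \<and> (\<forall>r\<in>HE n. H (1, r) = g r) \<and>
        (\<forall>s\<in>{0..1}. H (s, HE_base) = x0))"
proof -
  have "homotopic_with (\<lambda>h. h HE_base = x0) (HE_top n) X f g \<longleftrightarrow>
     (\<exists>H. continuous_map (prod_topology (top_of_set {0..1::real}) (HE_top n)) X H \<and>
        (\<forall>r\<in>topspace (HE_top n). H (0, r) = f r) \<and> (\<forall>r\<in>topspace (HE_top n). H (1, r) = g r) \<and>
        (\<forall>s\<in>{0..1}. H (s, HE_base) = x0))"
    by (rule homotopic_with) (use HE_base_in_HE[OF n] in force)
  then show ?thesis by simp
qed

lemma HE_map_iff: "HE_map n X x0 f \<longleftrightarrow> HE_homotopic n X x0 f f"
  by (simp add: HE_map_def)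

lemma HE_homotopic_imp_map:
  assumes "HE_homotopic n X x0 f g"
  shows "HE_map n X x0 f" and "HE_map n X x0 g"
  using homotopic_with_imp_continuous_maps[OF assms] homotopic_with_imp_property[OF assms]
  by (simp_all add: HE_map_def)

lemma HE_homotopic_cong:
  assumes "n \<ge> 1" "HE_homotopic n X x0 f g"
    and "\<And>r. r \<in> HE n \<Longrightarrow> f' r = f r" "\<And>r. r \<in> HE n \<Longrightarrow> g' r = g r"
  shows "HE_homotopic n X x0 f' g'"
  using assms by (simp add: HE_homotopic_iff)

lemma HE_class_eq_iff:
  "HE_map n X x0 g \<Longrightarrow> HE_class n X x0 f = HE_class n X x0 g \<longleftrightarrow> HE_homotopic n X x0 f g"
  unfolding HE_class_def by (rule homotopic_with_class_eq_iff) (simp only: HE_map_iff)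

text \<open>\<open>H\<close> is the composite of \<open>G\<close> with the quotient map, so
  continuity descends. Convergence of the spheres to the base point is absorbed into continuity of
  \<open>H\<close> at scale 0.\<close>

lemma continuous_map_from_HE:
  assumes n: "n \<ge> 1" and Z: "compact_space Z" "Hausdorff_space Z"
    and H: "continuous_map (prod_topology (prod_topology Z (top_of_set HE_scales)) (cube_top n)) X H"
    and eq: "\<And>z k t. z \<in> topspace Z \<Longrightarrow> k \<ge> 1 \<Longrightarrow> t \<in> cube n \<Longrightarrow> H ((z, 1 / real k), t) = G (z, sphere_char n k t)"
    and eq0: "\<And>z t. z \<in> topspace Z \<Longrightarrow> t \<in> cube n \<Longrightarrow> H ((z, 0), t) = G (z, HE_base)"
  shows "continuous_map (prod_topology Z (HE_top n)) X G"
proof (rule continuous_compose_quotient_map[OF quotient_map_HE_param[OF n Z]])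
  show "continuous_map (prod_topology (prod_topology Z (top_of_set HE_scales)) (cube_top n)) X
          (G \<circ> (\<lambda>((z, c), t). (z, HE_param n c t)))"
  proof (rule continuous_map_eq[OF H])
    fix w assume "w \<in> topspace (prod_topology (prod_topology Z (top_of_set HE_scales)) (cube_top n))"
    then obtain z c t where w: "w = ((z, c), t)" "z \<in> topspace Z" "c \<in> HE_scales" "t \<in> cube n"
      by auto
    from w(3) show "H w = (G \<circ> (\<lambda>((z, c), t). (z, HE_param n c t))) w"
      by (cases rule: HE_scales_cases) (simp_all add: w eq eq0 HE_param_0 HE_param_inverse)
  qed
qed

lemma HE_homotopic_sphere_char:
  assumes n: "n \<ge> 1" and k: "k \<ge> 1" and h: "HE_homotopic n X x0 f g"
  shows "cube_homotopic n X x0 (f \<circ> sphere_char n k) (g \<circ> sphere_char n k)"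
proof (rule homotopic_with_compose_continuous_map_right[OF h])
  have "continuous_map (cube_top n) (prod_topology (top_of_set HE_scales) (cube_top n)) (\<lambda>t. (1 / real k, t))"
    using inverse_in_HE_scales[OF k] by (intro continuous_map_pairedI continuous_map_const[THEN iffD2]) auto
  from continuous_map_compose[OF this continuous_map_HE_param[OF n]]
  show "continuous_map (cube_top n) (HE_top n) (sphere_char n k)"
    by (simp add: o_def HE_param_inverse[OF k])
qed (simp add: sphere_char_boundary[OF k])

lemma HE_map_sphere_char:
  "n \<ge> 1 \<Longrightarrow> k \<ge> 1 \<Longrightarrow> HE_map n X x0 f \<Longrightarrow> cube_map n X x0 (f \<circ> sphere_char n k)"
  unfolding HE_map_iff cube_map_iff by (rule HE_homotopic_sphere_char)

text \<open>The passage opposite to \<open>continuous_map_from_HE\<close>: a homotopy on the earring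
  is pulled up to the parameter space.\<close>

lemma continuous_map_compose_HE_param:
  assumes n: "n \<ge> 1" and F: "continuous_map (prod_topology (top_of_set {0..1::real}) (HE_top n)) X F"
  shows "continuous_map (prod_topology (prod_topology (top_of_set {0..1}) (top_of_set HE_scales)) (cube_top n)) X
           (\<lambda>w. F (fst (fst w), HE_param n (snd (fst w)) (snd w)))"
proof -
  have "quotient_map (prod_topology (prod_topology (top_of_set {0..1::real}) (top_of_set HE_scales)) (cube_top n))
           (prod_topology (top_of_set {0..1}) (HE_top n)) (\<lambda>((z, c), t). (z, HE_param n c t))"
    by (rule quotient_map_HE_param[OF n]) (auto simp: compact_space_subtopology Hausdorff_space_subtopology)
  from continuous_map_compose[OF quotient_imp_continuous_map[OF this] F]
  show ?thesis by (simp add: o_def case_prod_unfold)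
qed

section \<open>Concatenation of maps of the earring\<close>

lemma cube_concat_cong:
  assumes n: "n \<ge> 1" and t: "t \<in> cube n"
    and "\<And>s. s \<in> cube n \<Longrightarrow> f s = f' s" "\<And>s. s \<in> cube n \<Longrightarrow> g s = g' s"
  shows "cube_concat f g t = cube_concat f' g' t"
proof (cases "t 0 \<le> 1/2")
  case True
  then have "t(0 := 2 * t 0) \<in> cube n"
    using cube_coord_in[OF t n] by (intro cube_upd t n) auto
  then show ?thesis using True assms(3) by (simp add: cube_concat_def)
next
  case False
  then have "t(0 := 2 * t 0 - 1) \<in> cube n"
    using cube_coord_in[OF t n] by (intro cube_upd t n) auto
  then show ?thesis using False assms(4) by (simp add: cube_concat_def)
qed

lemma HE_concat_base:
  assumes n: "n \<ge> 1" and fg: "f HE_base = x0" "g HE_base = x0"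
  shows "HE_concat n f g HE_base = x0"
proof -
  let ?z = "\<lambda>_::nat. 0::real"
  have z: "?z \<in> cube_boundary n" by (rule zero_in_cube_boundary[OF n])
  then have "?z \<in> cube n" using cube_boundary_subset by blast
  then have "HE_concat n f g HE_base = cube_concat (f \<circ> sphere_char n 1) (g \<circ> sphere_char n 1) ?z"
    using HE_concat_sphere_char[where f = f and g = g, OF n order_refl _ fg, of ?z]
      sphere_char_boundary[of 1, OF _ z] by simp
  also have "\<dots> = x0"
    by (rule cube_concat_boundary[OF n z]) (use fg sphere_char_boundary[of 1] in simp_all)
  finally show ?thesis .
qed

lemma HE_concat_cong:
  assumes n: "n \<ge> 1" and r: "r \<in> HE n"
    and f: "\<And>r. r \<in> HE n \<Longrightarrow> f r = f' r" and g: "\<And>r. r \<in> HE n \<Longrightarrow> g r = g' r"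
    and fg: "f HE_base = x0" "g HE_base = x0"
  shows "HE_concat n f g r = HE_concat n f' g' r"
proof -
  obtain k t where r: "k \<ge> 1" "t \<in> cube n" "r = sphere_char n k t"
    using HE_cases[OF n r] .
  have fg': "f' HE_base = x0" "g' HE_base = x0" using f g fg HE_base_in_HE[OF n] by auto
  have "HE_concat n f g r = cube_concat (f \<circ> sphere_char n k) (g \<circ> sphere_char n k) t"
    unfolding r(3) by (rule HE_concat_sphere_char[where f = f and g = g, OF n r(1,2) fg])
  also have "\<dots> = cube_concat (f' \<circ> sphere_char n k) (g' \<circ> sphere_char n k) t"
    by (rule cube_concat_cong[OF n r(2)]) (use f g sphere_char_in_HE[OF n r(1)] in simp_all)
  also have "\<dots> = HE_concat n f' g' r"
    unfolding r(3) by (rule HE_concat_sphere_char[where f = f' and g = g', OF n r(1,2) fg', symmetric])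
  finally show ?thesis .
qed

text \<open>Both homotopies are pulled up to the parameter space, concatenated there in the cube
  coordinate with time and scale as parameters, and pushed down again. At scale 0 both are
  constantly \<open>x0\<close>, hence so is the concatenation.\<close>

lemma HE_homotopic_concat:
  assumes n: "n \<ge> 1" and f: "HE_homotopic n X x0 f f'" and g: "HE_homotopic n X x0 g g'"
  shows "HE_homotopic n X x0 (HE_concat n f g) (HE_concat n f' g')"
proof -
  obtain F where F: "continuous_map (prod_topology (top_of_set {0..1::real}) (HE_top n)) X F"
    "\<forall>r\<in>HE n. F (0, r) = f r" "\<forall>r\<in>HE n. F (1, r) = f' r" "\<forall>s\<in>{0..1}. F (s, HE_base) = x0"
    using f unfolding HE_homotopic_iff[OF n] by blast
  obtain G where G: "continuous_map (prod_topology (top_of_set {0..1::real}) (HE_top n)) X G"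
    "\<forall>r\<in>HE n. G (0, r) = g r" "\<forall>r\<in>HE n. G (1, r) = g' r" "\<forall>s\<in>{0..1}. G (s, HE_base) = x0"
    using g unfolding HE_homotopic_iff[OF n] by blast
  define F' where "F' w = F (fst (fst w), HE_param n (snd (fst w)) (snd w))" for w :: "(real \<times> real) \<times> (nat \<Rightarrow> real)"
  define G' where "G' w = G (fst (fst w), HE_param n (snd (fst w)) (snd w))" for w :: "(real \<times> real) \<times> (nat \<Rightarrow> real)"
  let ?H = "\<lambda>(s, r). HE_concat n (\<lambda>r. F (s, r)) (\<lambda>r. G (s, r)) r"
  let ?H' = "\<lambda>(z, t). cube_concat (\<lambda>t. F' (z, t)) (\<lambda>t. G' (z, t)) t"
  have base: "HE_concat n (\<lambda>r. F (s, r)) (\<lambda>r. G (s, r)) HE_base = x0" if "s \<in> {0..1}" for s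
    by (rule HE_concat_base[OF n]) (use F(4) G(4) that in auto)
  show ?thesis
    unfolding HE_homotopic_iff[OF n]
  proof (intro exI[of _ ?H] conjI ballI)
    show "continuous_map (prod_topology (top_of_set {0..1}) (HE_top n)) X ?H"
    proof (rule continuous_map_from_HE[OF n])
      have "continuous_map (prod_topology (prod_topology (top_of_set {0..1}) (top_of_set HE_scales)) (cube_top n)) X F'"
        "continuous_map (prod_topology (prod_topology (top_of_set {0..1}) (top_of_set HE_scales)) (cube_top n)) X G'"
        unfolding F'_def G'_def by (rule continuous_map_compose_HE_param[OF n F(1)] continuous_map_compose_HE_param[OF n G(1)])+
      then show "continuous_map (prod_topology (prod_topology (top_of_set {0..1}) (top_of_set HE_scales)) (cube_top n)) X ?H'"
        by (rule continuous_map_cube_concat[OF n])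
          (use F(4) G(4) in \<open>auto simp: HE_param_boundary F'_def G'_def\<close>)
    next
      fix s :: real and k :: nat and t :: "nat \<Rightarrow> real"
      assume s: "s \<in> topspace (top_of_set {0..1})" and k: "k \<ge> 1" and t: "t \<in> cube n"
      have "HE_concat n (\<lambda>r. F (s, r)) (\<lambda>r. G (s, r)) (sphere_char n k t)
          = cube_concat ((\<lambda>r. F (s, r)) \<circ> sphere_char n k) ((\<lambda>r. G (s, r)) \<circ> sphere_char n k) t"
        by (rule HE_concat_sphere_char[OF n k t]) (use F(4) G(4) s in auto)
      then show "?H' ((s, 1 / real k), t) = ?H (s, sphere_char n k t)"
        using k by (simp add: F'_def G'_def HE_param_inverse o_def)
    next
      fix s :: real and t :: "nat \<Rightarrow> real"
      assume s: "s \<in> topspace (top_of_set {0..1})"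
      then show "?H' ((s, 0), t) = ?H (s, HE_base)"
        using F(4) G(4) base by (simp add: F'_def G'_def HE_param_0 cube_concat_def)
    qed (auto simp: compact_space_subtopology Hausdorff_space_subtopology)
    fix r assume r: "r \<in> HE n"
    show "?H (0, r) = HE_concat n f g r" "?H (1, r) = HE_concat n f' g' r"
      using HE_concat_cong[OF n r, of "\<lambda>r. F (0, r)" f "\<lambda>r. G (0, r)" g x0]
        HE_concat_cong[OF n r, of "\<lambda>r. F (1, r)" f' "\<lambda>r. G (1, r)" g' x0] F G by simp_all
  next
    show "?H (s, HE_base) = x0" if "s \<in> {0..1}" for s
      using base that by simp
  qed
qed

lemma HE_map_concat:
  "n \<ge> 1 \<Longrightarrow> HE_map n X x0 f \<Longrightarrow> HE_map n X x0 g \<Longrightarrow> HE_map n X x0 (HE_concat n f g)"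
  unfolding HE_map_iff by (rule HE_homotopic_concat)

lemma mult_Hawaiian_group:
  assumes n: "n \<ge> 1" and f: "HE_map n X x0 f" and g: "HE_map n X x0 g"
  shows "HE_class n X x0 f \<otimes>\<^bsub>Hawaiian_group n X x0\<^esub> HE_class n X x0 g
           = HE_class n X x0 (HE_concat n f g)"
proof -
  have "HE_class n X x0 (HE_concat n f' g') = HE_class n X x0 (HE_concat n f g)"
    if "f' \<in> HE_class n X x0 f" "g' \<in> HE_class n X x0 g" for f' g'
  proof -
    have "HE_homotopic n X x0 f f'" "HE_homotopic n X x0 g g'"
      using that by (simp_all add: HE_class_def)
    then have "HE_homotopic n X x0 (HE_concat n f' g') (HE_concat n f g)"
      by (rule homotopic_with_symD[OF HE_homotopic_concat[OF n]])
    then show ?thesis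
      by (simp only: HE_class_eq_iff[OF HE_homotopic_imp_map(2)])
  qed
  moreover have "f \<in> HE_class n X x0 f" "g \<in> HE_class n X x0 g"
    using f g by (simp_all add: HE_class_def HE_map_def)
  ultimately show ?thesis
    unfolding Hawaiian_group_def monoid.simps by (intro UN_UN_const)
qed

section \<open>Modifying finitely many spheres\<close>

text \<open>The map with prescribed composites \<open>F k\<close> on the spheres. As in
  \<open>HE_concat\<close>, a parameter is selected by an inverse; the choice is immaterial once all
  \<open>F k\<close> have one common value on the boundary.\<close>

definition HE_lift :: "nat \<Rightarrow> (nat \<Rightarrow> (nat \<Rightarrow> real) \<Rightarrow> 'a) \<Rightarrow> (nat \<Rightarrow> real) \<Rightarrow> 'a" where
  "HE_lift n F r = (case inv_into ({1..} \<times> cube n) (\<lambda>(k, t). sphere_char n k t) r of (k, t) \<Rightarrow> F k t)"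

text \<open>Spheres are numbered from 1, so exactly the first \<open>K - 1\<close> of them are
  replaced, and \<open>K = 1\<close> replaces none.\<close>

definition HE_glue ::
  "nat \<Rightarrow> nat \<Rightarrow> (nat \<Rightarrow> (nat \<Rightarrow> real) \<Rightarrow> 'a) \<Rightarrow> ((nat \<Rightarrow> real) \<Rightarrow> 'a) \<Rightarrow> (nat \<Rightarrow> real) \<Rightarrow> 'a" where
  "HE_glue n K F f = HE_lift n (\<lambda>k t. if k < K then F k t else f (sphere_char n k t))"

text \<open>Away from the base point the parameter is unique. Over the base point every parameter
  lies in a cube boundary, where all \<open>F k\<close> equal \<open>x0\<close>.\<close>

lemma HE_lift_sphere_char:
  assumes k: "k \<ge> 1" and t: "t \<in> cube n"
    and bd: "\<And>k t. k \<ge> 1 \<Longrightarrow> t \<in> cube_boundary n \<Longrightarrow> F k t = x0"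
  shows "HE_lift n F (sphere_char n k t) = F k t"
proof -
  let ?F = "\<lambda>(k, t). sphere_char n k t"
  let ?A = "{1..} \<times> cube n"
  obtain l s where ls: "inv_into ?A ?F (sphere_char n k t) = (l, s)" by force
  have im: "sphere_char n k t \<in> ?F ` ?A" using k t by force
  have "(l, s) \<in> ?A" using inv_into_into[OF im] ls by simp
  moreover have "?F (l, s) = sphere_char n k t" using f_inv_into_f[OF im] ls by simp
  ultimately have l: "l \<ge> 1" "s \<in> cube n" "sphere_char n l s = sphere_char n k t" by auto
  have lhs: "HE_lift n F (sphere_char n k t) = F l s"
    unfolding HE_lift_def ls by simp
  show ?thesis
  proof (cases "sphere_char n k t = HE_base")
    case True
    have "s \<in> cube_boundary n"
      using True l(3) sphere_char_eq_base_iff[OF l(1), of n s] bump_eq_0_iff[OF l(2)] by simp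
    moreover have "t \<in> cube_boundary n"
      using True sphere_char_eq_base_iff[OF k, of n t] bump_eq_0_iff[OF t] by simp
    ultimately show ?thesis using lhs bd[OF l(1)] bd[OF k] by simp
  next
    case False
    then have "l = k" "s = t"
      using sphere_char_inject[OF l(1) k l(2) t l(3)] unfolding l(3) by blast+
    then show ?thesis using lhs by blast
  qed
qed

lemma HE_glue_sphere_char:
  assumes k: "k \<ge> 1" and t: "t \<in> cube n" and f: "f HE_base = x0"
    and bd: "\<And>k t. k \<ge> 1 \<Longrightarrow> k < K \<Longrightarrow> t \<in> cube_boundary n \<Longrightarrow> F k t = x0"
  shows "HE_glue n K F f (sphere_char n k t) = (if k < K then F k t else f (sphere_char n k t))"
  unfolding HE_glue_def
  by (rule HE_lift_sphere_char[OF k t, where ?x0.0 = x0]) (use f bd sphere_char_boundary in auto)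

lemma HE_glue_base:
  assumes n: "n \<ge> 1" and f: "f HE_base = x0"
    and bd: "\<And>k t. k \<ge> 1 \<Longrightarrow> k < K \<Longrightarrow> t \<in> cube_boundary n \<Longrightarrow> F k t = x0"
  shows "HE_glue n K F f HE_base = x0"
proof -
  let ?z = "\<lambda>_::nat. 0::real"
  have z: "?z \<in> cube_boundary n" by (rule zero_in_cube_boundary[OF n])
  then have zc: "?z \<in> cube n" using cube_boundary_subset by blast
  have "HE_glue n K F f (sphere_char n 1 ?z) = (if 1 < K then F 1 ?z else f (sphere_char n 1 ?z))"
    by (rule HE_glue_sphere_char[where ?x0.0 = x0]) (use zc f bd in auto)
  then show ?thesis
    using sphere_char_boundary[of 1, OF _ z] bd[of 1, OF _ _ z] f by (simp split: if_splits)
qed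

text \<open>The radii of the first \<open>K - 1\<close> spheres are isolated points of
  \<open>HE_scales\<close>, so upstairs the homotopies on these spheres and the one on the rest live
  on disjoint open pieces. Only finitely many pieces are split off, and the limit scale 0 stays with
  the homotopy from \<open>f\<close> to \<open>g\<close>.\<close>

lemma HE_homotopic_glue:
  assumes n: "n \<ge> 1" and f: "HE_homotopic n X x0 f g"
    and FG: "\<And>k. k \<ge> 1 \<Longrightarrow> k < K \<Longrightarrow> cube_homotopic n X x0 (F k) (G k)"
  shows "HE_homotopic n X x0 (HE_glue n K F f) (HE_glue n K G g)"
proof -
  let ?I = "top_of_set {0..1::real}"
  let ?W = "prod_topology (prod_topology ?I (top_of_set HE_scales)) (cube_top n)"
  obtain P where P: "continuous_map (prod_topology ?I (HE_top n)) X P"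
    "\<forall>r\<in>HE n. P (0, r) = f r" "\<forall>r\<in>HE n. P (1, r) = g r" "\<forall>s\<in>{0..1}. P (s, HE_base) = x0"
    using f unfolding HE_homotopic_iff[OF n] by blast
  have "\<forall>k\<in>{1..<K}. \<exists>Q. continuous_map (prod_topology ?I (cube_top n)) X Q \<and>
        (\<forall>t\<in>cube n. Q (0, t) = F k t) \<and> (\<forall>t\<in>cube n. Q (1, t) = G k t) \<and>
        (\<forall>s\<in>{0..1}. \<forall>t\<in>cube_boundary n. Q (s, t) = x0)"
  proof
    fix k assume "k \<in> {1..<K}"
    then have "cube_homotopic n X x0 (F k) (G k)" using FG[of k] by simp
    then show "\<exists>Q. continuous_map (prod_topology ?I (cube_top n)) X Q \<and>
        (\<forall>t\<in>cube n. Q (0, t) = F k t) \<and> (\<forall>t\<in>cube n. Q (1, t) = G k t) \<and>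
        (\<forall>s\<in>{0..1}. \<forall>t\<in>cube_boundary n. Q (s, t) = x0)"
      unfolding cube_homotopic_iff .
  qed
  from bchoice[OF this] obtain Q where Q: "\<And>k. k \<in> {1..<K} \<Longrightarrow> continuous_map (prod_topology ?I (cube_top n)) X (Q k)"
    "\<And>k t. k \<in> {1..<K} \<Longrightarrow> t \<in> cube n \<Longrightarrow> Q k (0, t) = F k t"
    "\<And>k t. k \<in> {1..<K} \<Longrightarrow> t \<in> cube n \<Longrightarrow> Q k (1, t) = G k t"
    "\<And>k s t. k \<in> {1..<K} \<Longrightarrow> s \<in> {0..1} \<Longrightarrow> t \<in> cube_boundary n \<Longrightarrow> Q k (s, t) = x0"
    by blast
  let ?H = "\<lambda>(s, r). HE_glue n K (\<lambda>k t. Q k (s, t)) (\<lambda>r. P (s, r)) r"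
  define S where "S = (\<lambda>k. 1 / real k) ` {1..<K}"
  \<comment> \<open>For \<open>c = 1 / k\<close> the floor of \<open>1 / c\<close> recovers the
    number of the sphere. At scale 0, which is not in \<open>S\<close>, the second branch
    applies.\<close>
  define h where "h w = (let c = snd (fst w) in if c \<in> S then Q (nat \<lfloor>1 / c\<rfloor>) (fst (fst w), snd w)
      else P (fst (fst w), HE_param n c (snd w)))" for w :: "(real \<times> real) \<times> (nat \<Rightarrow> real)"
  have index: "nat \<lfloor>1 / (1 / real k)\<rfloor> = k" for k by simp
  have S_iff: "1 / real k \<in> S \<longleftrightarrow> k < K" if "k \<ge> 1" for k
    using that by (auto simp: S_def)
  have cont_c: "continuous_map ?W (top_of_set HE_scales) (\<lambda>w. snd (fst w))"
    using continuous_map_compose[OF continuous_map_fst continuous_map_snd] unfolding o_def .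
  have cont_s: "continuous_map ?W ?I (\<lambda>w. fst (fst w))"
    using continuous_map_compose[OF continuous_map_fst continuous_map_fst] unfolding o_def .
  \<comment> \<open>Pasting over an open cover: index \<open>i > 0\<close> stands for the single
    radius \<open>1 / i\<close>. Index 0 is not the number of a sphere and is free to stand for all
    other scales.\<close>
  have "continuous_map ?W X h"
  proof (rule pasting_lemma)
    let ?T = "\<lambda>i. {w \<in> topspace ?W. snd (fst w) \<in> (if i = 0 then HE_scales - S else {1 / real i})}"
    let ?g = "\<lambda>i w. if i = 0 then P (fst (fst w), HE_param n (snd (fst w)) (snd w)) else Q i (fst (fst w), snd w)"
    show "openin ?W (?T i)" if "i \<in> insert 0 {1..<K}" for i
    proof (rule openin_continuous_map_preimage[OF cont_c])
      have "closed S" unfolding S_def by (intro finite_imp_closed) simp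
      then have "openin (top_of_set HE_scales) (HE_scales - S)"
        by (simp add: Diff_eq openin_open_Int open_Compl)
      then show "openin (top_of_set HE_scales) (if i = 0 then HE_scales - S else {1 / real i})"
        using openin_HE_scales_singleton[of i] by simp
    qed
    show "continuous_map (subtopology ?W (?T i)) X (?g i)" if i: "i \<in> insert 0 {1..<K}" for i
    proof (rule continuous_map_from_subtopology, cases "i = 0")
      case True
      then show "continuous_map ?W X (?g i)" using continuous_map_compose_HE_param[OF n P(1)] by simp
    next
      case False
      have "continuous_map ?W (prod_topology ?I (cube_top n)) (\<lambda>w. (fst (fst w), snd w))"
        by (intro continuous_map_pairedI cont_s continuous_map_snd)
      from continuous_map_compose[OF this Q(1)[of i]] False i
      show "continuous_map ?W X (?g i)" by (simp add: o_def)
    qed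
    show "?g i w = ?g j w"
      if "i \<in> insert 0 {1..<K}" "j \<in> insert 0 {1..<K}" "w \<in> topspace ?W \<inter> ?T i \<inter> ?T j" for i j w
    proof (cases "i = 0 \<longleftrightarrow> j = 0")
      case True
      then show ?thesis using that by (auto split: if_splits)
    next
      case False
      then show ?thesis using that S_iff[of i] S_iff[of j] by (auto split: if_splits)
    qed
    show "\<exists>j. j \<in> insert 0 {1..<K} \<and> w \<in> ?T j \<and> h w = ?g j w" if w: "w \<in> topspace ?W" for w
    proof (cases "snd (fst w) \<in> S")
      case True
      then obtain k where k: "1 \<le> k" "k < K" "snd (fst w) = 1 / real k" by (auto simp: S_def)
      then have "h w = Q k (fst (fst w), snd w)"
        using True index[of k] unfolding h_def Let_def by (simp only: if_True)
      then show ?thesis using k w by (intro exI[of _ k]) simp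
    next
      case False
      then have "h w = P (fst (fst w), HE_param n (snd (fst w)) (snd w))"
        by (simp add: h_def)
      then show ?thesis using False w by (intro exI[of _ 0]) auto
    qed
  qed
  have base: "?H (s, HE_base) = x0" if "s \<in> {0..1}" for s
    using that HE_glue_base[OF n, of "\<lambda>r. P (s, r)" x0 K "\<lambda>k t. Q k (s, t)"] P(4) Q(4) by simp
  have val: "?H (s, sphere_char n k t) = (if k < K then Q k (s, t) else P (s, sphere_char n k t))"
    if "s \<in> {0..1}" "k \<ge> 1" "t \<in> cube n" for s k t
    using that HE_glue_sphere_char[of k t n "\<lambda>r. P (s, r)" x0 K "\<lambda>k t. Q k (s, t)"] P(4) Q(4) by simp
  show ?thesis
    unfolding HE_homotopic_iff[OF n]
  proof (intro exI[of _ ?H] conjI ballI)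
    show "continuous_map (prod_topology ?I (HE_top n)) X ?H"
    proof (rule continuous_map_from_HE[OF n _ _ \<open>continuous_map ?W X h\<close>])
      fix s :: real and k :: nat and t :: "nat \<Rightarrow> real"
      assume "s \<in> topspace ?I" "k \<ge> 1" "t \<in> cube n"
      then show "h ((s, 1 / real k), t) = ?H (s, sphere_char n k t)"
        using val[of s k t] index[of k] S_iff[of k] HE_param_inverse[of k n t]
        unfolding h_def Let_def fst_conv snd_conv by simp
    next
      fix s :: real and t :: "nat \<Rightarrow> real"
      assume s: "s \<in> topspace ?I" "t \<in> cube n"
      have "0 \<notin> S" by (auto simp: S_def)
      then show "h ((s, 0), t) = ?H (s, HE_base)"
        using base[of s] s P(4) by (simp add: h_def HE_param_0)
    qed (auto simp: compact_space_subtopology Hausdorff_space_subtopology)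
    have map: "f HE_base = x0" "g HE_base = x0"
      using HE_homotopic_imp_map[OF f] by (simp_all add: HE_map_def)
    have bd: "F k t = x0 \<and> G k t = x0" if "k \<ge> 1" "k < K" "t \<in> cube_boundary n" for k t
      using cube_homotopic_imp_map[OF FG[OF that(1,2)]] that(3) by (simp add: cube_map_def)
    fix r assume "r \<in> HE n"
    then obtain k t where r: "k \<ge> 1" "t \<in> cube n" "r = sphere_char n k t"
      using HE_cases[OF n] by blast
    show "?H (0, r) = HE_glue n K F f r"
      using val[of 0 k t] HE_glue_sphere_char[of k t n f x0 K F] r map bd P(2) Q(2)[of k t] sphere_char_in_HE[OF n r(1,2)]
      by (simp add: atLeastLessThan_iff)
    show "?H (1, r) = HE_glue n K G g r"
      using val[of 1 k t] HE_glue_sphere_char[of k t n g x0 K G] r map bd P(3) Q(3)[of k t] sphere_char_in_HE[OF n r(1,2)]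
      by (simp add: atLeastLessThan_iff)
  qed (use base in auto)
qed

lemma HE_map_glue:
  assumes "n \<ge> 1" "HE_map n X x0 f" "\<And>k. k \<ge> 1 \<Longrightarrow> k < K \<Longrightarrow> cube_map n X x0 (F k)"
  shows "HE_map n X x0 (HE_glue n K F f)"
  using assms unfolding HE_map_iff cube_map_iff by (intro HE_homotopic_glue)

text \<open>Upstairs, the preimage of \<open>V\<close> is an open set containing the whole slice
  over scale 0. As the cube is compact, the tube lemma gives a neighbourhood of 0 in the scales
  whose slices all lie in that preimage.\<close>

lemma HE_map_eventually_in:
  assumes n: "n \<ge> 1" and f: "HE_map n X x0 f" and V: "openin X V" "x0 \<in> V"
  obtains K where "K \<ge> 1" "\<And>k t. k \<ge> K \<Longrightarrow> t \<in> cube n \<Longrightarrow> f (sphere_char n k t) \<in> V"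
proof -
  let ?W = "prod_topology (top_of_set HE_scales) (cube_top n)"
  let ?O = "{w \<in> topspace ?W. f (HE_param n (fst w) (snd w)) \<in> V}"
  have "continuous_map ?W X (\<lambda>w. f (HE_param n (fst w) (snd w)))"
    using continuous_map_compose[OF continuous_map_HE_param[OF n], of X f] f
    by (simp add: HE_map_def o_def)
  then have O: "openin ?W ?O" using V(1) by (rule openin_continuous_map_preimage)
  have 0: "0 \<in> HE_scales" by (simp add: HE_scales_def)
  have "{0} \<times> cube n \<subseteq> ?O"
    using 0 V(2) f by (auto simp: HE_param_0 HE_map_def)
  moreover have "compactin (cube_top n) (cube n)"
    using compact_space_cube_top[of n] by (simp add: compact_space_def)
  ultimately obtain U C where U: "openin (top_of_set HE_scales) U" "0 \<in> U" "cube n \<subseteq> C" "U \<times> C \<subseteq> ?O"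
    using tube_lemma_right[OF O, of "cube n" 0] 0 by auto
  obtain T where T: "open T" "U = HE_scales \<inter> T"
    using U(1) by (auto simp: openin_open)
  have "(\<lambda>k. 1 / real k) \<longlonglongrightarrow> 0" by (rule lim_1_over_n)
  then have "\<forall>\<^sub>F k in sequentially. 1 / real k \<in> T"
    using T U(2) by (auto dest: topological_tendstoD)
  then obtain K where K: "\<And>k. k \<ge> K \<Longrightarrow> 1 / real k \<in> T"
    by (auto simp: eventually_sequentially)
  show thesis
  proof (rule that[of "max 1 K"])
    fix k t assume k: "max 1 K \<le> k" and t: "t \<in> cube n"
    then have "1 / real k \<in> U" using K[of k] T(2) inverse_in_HE_scales[of k] by auto
    then have "(1 / real k, t) \<in> ?O" using U(3,4) t by blast
    then show "f (sphere_char n k t) \<in> V" using k HE_param_inverse[of k n t] by simp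
  qed simp
qed

section \<open>The splitting\<close>

text \<open>The bound \<open>K \<ge> 1\<close> ensures that every index of the tail numbers a
  sphere.\<close>

definition HE_tail_in :: "nat \<Rightarrow> 'a set \<Rightarrow> nat \<Rightarrow> ((nat \<Rightarrow> real) \<Rightarrow> 'a) \<Rightarrow> bool" where
  "HE_tail_in n V K f \<longleftrightarrow> K \<ge> 1 \<and> (\<forall>k\<ge>K. \<forall>t\<in>cube n. f (sphere_char n k t) \<in> V)"

abbreviation HE_trunc :: "nat \<Rightarrow> 'a \<Rightarrow> nat \<Rightarrow> ((nat \<Rightarrow> real) \<Rightarrow> 'a) \<Rightarrow> (nat \<Rightarrow> real) \<Rightarrow> 'a" where
  "HE_trunc n x0 K \<equiv> HE_glue n K (\<lambda>_ _. x0)"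

lemma HE_tail_in_mono: "HE_tail_in n V K f \<Longrightarrow> K \<le> K' \<Longrightarrow> HE_tail_in n V K' f"
  by (auto simp: HE_tail_in_def)

lemma HE_trunc_sphere_char:
  assumes "k \<ge> 1" "t \<in> cube n" "f HE_base = x0"
  shows "HE_trunc n x0 K f (sphere_char n k t) = (if k < K then x0 else f (sphere_char n k t))"
  by (rule HE_glue_sphere_char[where f = f, OF assms]) simp

lemma HE_glue_self:
  assumes n: "n \<ge> 1" and r: "r \<in> HE n" and f: "f HE_base = x0"
  shows "HE_glue n K (\<lambda>k. f \<circ> sphere_char n k) f r = f r"
proof -
  obtain k t where r: "k \<ge> 1" "t \<in> cube n" "r = sphere_char n k t"
    using HE_cases[OF n r] .
  have "HE_glue n K (\<lambda>k. f \<circ> sphere_char n k) f (sphere_char n k t)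
      = (if k < K then (f \<circ> sphere_char n k) t else f (sphere_char n k t))"
    by (rule HE_glue_sphere_char[where ?x0.0 = x0 and f = f, OF r(1,2) f]) (use f in \<open>simp add: sphere_char_boundary\<close>)
  then show ?thesis using r(3) by simp
qed

lemma HE_glue_trunc:
  assumes n: "n \<ge> 1" and r: "r \<in> HE n" and f: "f HE_base = x0"
    and F: "\<And>k t. k \<ge> 1 \<Longrightarrow> k < K \<Longrightarrow> t \<in> cube_boundary n \<Longrightarrow> F k t = x0"
  shows "HE_glue n K F (HE_trunc n x0 K f) r = HE_glue n K F f r"
proof -
  obtain k t where r: "k \<ge> 1" "t \<in> cube n" "r = sphere_char n k t"
    using HE_cases[OF n r] .
  have b: "HE_trunc n x0 K f HE_base = x0"
    by (rule HE_glue_base[where ?x0.0 = x0 and f = f, OF n f]) simp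
  have "HE_glue n K F (HE_trunc n x0 K f) (sphere_char n k t)
      = (if k < K then F k t else HE_trunc n x0 K f (sphere_char n k t))"
    by (rule HE_glue_sphere_char[where ?x0.0 = x0 and f = "HE_trunc n x0 K f" and F = F, OF r(1,2) b F])
  also have "\<dots> = HE_glue n K F f (sphere_char n k t)"
    using HE_glue_sphere_char[where ?x0.0 = x0 and f = f and F = F, OF r(1,2) f F] HE_trunc_sphere_char[where f = f, OF r(1,2) f] by simp
  finally show ?thesis using r(3) by simp
qed

text \<open>A map is rebuilt by glueing its own first \<open>K - 1\<close> restrictions onto its
  truncation, and glueing respects homotopy. This is the reason for injectivity of the splitting
  map.\<close>

lemma HE_homotopic_if_trunc:
  assumes n: "n \<ge> 1" and f: "HE_map n X x0 f" and g: "HE_map n X x0 g"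
    and tr: "HE_homotopic n X x0 (HE_trunc n x0 K f) (HE_trunc n x0 K g)"
    and sph: "\<And>k. k \<ge> 1 \<Longrightarrow> k < K \<Longrightarrow> cube_homotopic n X x0 (f \<circ> sphere_char n k) (g \<circ> sphere_char n k)"
  shows "HE_homotopic n X x0 f g"
proof (rule HE_homotopic_cong[OF n HE_homotopic_glue[OF n tr sph]])
  fix r assume r: "r \<in> HE n"
  have *: "h r = HE_glue n K (\<lambda>k. h \<circ> sphere_char n k) (HE_trunc n x0 K h) r" if "h HE_base = x0" for h :: "(nat \<Rightarrow> real) \<Rightarrow> 'a"
  proof -
    have "HE_glue n K (\<lambda>k. h \<circ> sphere_char n k) (HE_trunc n x0 K h) r = HE_glue n K (\<lambda>k. h \<circ> sphere_char n k) h r"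
      by (rule HE_glue_trunc[where f = h, OF n r that]) (use that in \<open>simp add: sphere_char_boundary\<close>)
    then show ?thesis using HE_glue_self[of n r h, OF n r that] by simp
  qed
  show "f r = HE_glue n K (\<lambda>k. f \<circ> sphere_char n k) (HE_trunc n x0 K f) r"
    "g r = HE_glue n K (\<lambda>k. g \<circ> sphere_char n k) (HE_trunc n x0 K g) r"
    using * f g by (simp_all add: HE_map_def)
qed

text \<open>An equality of maps on the earring, not just a homotopy: concatenation acts on each
  sphere separately, and on a truncated sphere the concatenation of two constants is the same
  constant.\<close>

lemma HE_trunc_concat:
  assumes n: "n \<ge> 1" and r: "r \<in> HE n" and fg: "f HE_base = x0" "g HE_base = x0"
  shows "HE_trunc n x0 K (HE_concat n f g) r = HE_concat n (HE_trunc n x0 K f) (HE_trunc n x0 K g) r"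
proof -
  obtain k t where r: "k \<ge> 1" "t \<in> cube n" "r = sphere_char n k t"
    using HE_cases[OF n r] .
  have b: "HE_trunc n x0 K f HE_base = x0" "HE_trunc n x0 K g HE_base = x0"
    by (rule HE_glue_base[where ?x0.0 = x0, OF n]; simp add: fg)+
  have "HE_concat n (HE_trunc n x0 K f) (HE_trunc n x0 K g) (sphere_char n k t)
      = cube_concat (HE_trunc n x0 K f \<circ> sphere_char n k) (HE_trunc n x0 K g \<circ> sphere_char n k) t"
    by (rule HE_concat_sphere_char[where f = "HE_trunc n x0 K f" and g = "HE_trunc n x0 K g", OF n r(1,2) b])
  also have "\<dots> = cube_concat (if k < K then \<lambda>_. x0 else f \<circ> sphere_char n k) (if k < K then \<lambda>_. x0 else g \<circ> sphere_char n k) t"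
    by (rule cube_concat_cong[OF n r(2)])
      (simp_all add: HE_trunc_sphere_char[where f = f, OF r(1) _ fg(1)] HE_trunc_sphere_char[where f = g, OF r(1) _ fg(2)])
  also have "\<dots> = (if k < K then x0 else cube_concat (f \<circ> sphere_char n k) (g \<circ> sphere_char n k) t)"
    by (simp add: cube_concat_def)
  also have "\<dots> = HE_trunc n x0 K (HE_concat n f g) (sphere_char n k t)"
    using HE_trunc_sphere_char[where f = "HE_concat n f g", OF r(1,2) HE_concat_base[where f = f and g = g, OF n fg]]
      HE_concat_sphere_char[where f = f and g = g, OF n r(1,2) fg] by simp
  finally show ?thesis using r(3) by simp
qed

proposition Hawaiian_group_splitting:
  assumes n: "n \<ge> 1" and V: "openin X V" "x0 \<in> V"
    and null: "\<And>g. cube_map n (subtopology X V) x0 g \<Longrightarrow> cube_homotopic n X x0 g (\<lambda>_. x0)"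
  shows "Hawaiian_group n X x0 \<cong>
    (Hawaiian_group n X x0)
      \<lparr>carrier := Hawaiian_group_induced n X x0 id ` carrier (Hawaiian_group n (subtopology X V) x0)\<rparr>
    \<times>\<times> sum_group (UNIV :: nat set) (\<lambda>_. homotopy_group n X x0)"
    (is "?H \<cong> ?J \<times>\<times> ?S")
proof -
  let ?\<pi> = "homotopy_group n X x0"
  have x0: "x0 \<in> topspace X" using V openin_subset by blast
  note homotopic_with_trans [trans]
  note group_\<pi> = group_homotopy_group[OF n x0]
  have const: "cube_map n X x0 (\<lambda>_. x0)" by (rule cube_map_const[OF x0])

  \<comment> \<open>Elements of the groups and their representatives\<close>
  have carrH: "A \<in> carrier ?H \<longleftrightarrow> (\<exists>f. A = HE_class n X x0 f \<and> HE_map n X x0 f)" for A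
    by (auto simp: Hawaiian_group_def)
  have carr\<pi>: "A \<in> carrier ?\<pi> \<longleftrightarrow> (\<exists>f. A = cube_class n X x0 f \<and> cube_map n X x0 f)" for A
    by (auto simp: homotopy_group_def)
  have one\<pi>: "\<one>\<^bsub>?\<pi>\<^esub> = cube_class n X x0 (\<lambda>_. x0)" by (simp add: homotopy_group_def)
  have sub_homotopic: "HE_homotopic n X x0 f g" if "HE_homotopic n (subtopology X V) x0 f g" for f g
    using homotopic_with_compose_continuous_map_left[OF that, of X id "\<lambda>h. h HE_base = x0"] by simp
  have sub_map: "HE_map n X x0 f" if "HE_map n (subtopology X V) x0 f" for f
    using sub_homotopic that unfolding HE_map_iff .
  \<comment> \<open>The inclusion sends the class of \<open>f\<close> in \<open>V\<close> to its
    class in \<open>X\<close>, so the subgroup consists of the classes in \<open>X\<close> that have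
    a representative with values in \<open>V\<close>. Distinct classes in \<open>V\<close> may
    become equal.\<close>
  have carrJ: "A \<in> carrier ?J \<longleftrightarrow> (\<exists>f. A = HE_class n X x0 f \<and> HE_map n (subtopology X V) x0 f)" for A
  proof -
    have ind: "Hawaiian_group_induced n X x0 id (HE_class n (subtopology X V) x0 f) = HE_class n X x0 f"
      if f: "HE_map n (subtopology X V) x0 f" for f
    proof -
      let ?A = "HE_class n (subtopology X V) x0 f"
      have "HE_class n X x0 (id \<circ> g) = HE_class n X x0 f" if "g \<in> ?A" for g
      proof -
        have "HE_homotopic n X x0 g f"
          using that by (intro homotopic_with_symD[OF sub_homotopic]) (simp add: HE_class_def)
        then show ?thesis by (simp only: id_comp HE_class_eq_iff[OF sub_map[OF f]])
      qed
      then have "Hawaiian_group_induced n X x0 id ?A = (\<Union>g\<in>?A. HE_class n X x0 f)"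
        unfolding Hawaiian_group_induced_def by (intro SUP_cong refl)
      moreover have "f \<in> ?A" using f by (simp add: HE_class_def HE_map_def)
      ultimately show ?thesis by auto
    qed
    have "carrier (Hawaiian_group n (subtopology X V) x0) = HE_class n (subtopology X V) x0 ` {f. HE_map n (subtopology X V) x0 f}"
      by (auto simp: Hawaiian_group_def)
    then have "carrier ?J = (\<lambda>f. Hawaiian_group_induced n X x0 id (HE_class n (subtopology X V) x0 f)) ` {f. HE_map n (subtopology X V) x0 f}"
      by (simp add: image_image)
    also have "\<dots> = HE_class n X x0 ` {f. HE_map n (subtopology X V) x0 f}"
      by (intro image_cong refl ind) simp
    finally show ?thesis by blast
  qed
  have carrS: "carrier ?S = {b. (\<forall>k. b k \<in> carrier ?\<pi>) \<and> finite {k. b k \<noteq> \<one>\<^bsub>?\<pi>\<^esub>}}"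
    using group_\<pi> by (auto simp: carrier_sum_group)

  \<comment> \<open>Behaviour of truncations up to homotopy\<close>
  have tail_ex: "\<exists>K. HE_tail_in n V K f" if "HE_map n X x0 f" for f
    using HE_map_eventually_in[OF n that V] unfolding HE_tail_in_def by metis
  have trunc_cong: "HE_homotopic n X x0 (HE_trunc n x0 K f) (HE_trunc n x0 K g)"
    if "HE_homotopic n X x0 f g" for f g K
    by (rule HE_homotopic_glue[OF n that]) (use const in \<open>simp add: cube_map_iff\<close>)
  have tail_null: "cube_homotopic n X x0 (f \<circ> sphere_char n k) (\<lambda>_. x0)"
    if f: "HE_map n X x0 f" "HE_tail_in n V K f" and k: "k \<ge> K" for f K k
  proof (rule null)
    have k1: "k \<ge> 1" using f(2) k by (simp add: HE_tail_in_def)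
    have "cube_map n X x0 (f \<circ> sphere_char n k)" by (rule HE_map_sphere_char[OF n k1 f(1)])
    moreover have "f (sphere_char n k t) \<in> V" if "t \<in> cube n" for t
      using f(2) k that by (simp add: HE_tail_in_def)
    ultimately show "cube_map n (subtopology X V) x0 (f \<circ> sphere_char n k)"
      by (auto simp: cube_map_def continuous_map_in_subtopology)
  qed
  \<comment> \<open>The truncation at \<open>K\<close> is written as a glueing at the larger index
    \<open>K'\<close>. It differs from the truncation at \<open>K'\<close> only on the spheres from
    \<open>K\<close> to \<open>K' - 1\<close>: finitely many, and all contractible in
    \<open>X\<close>.\<close>
  have trunc_le: "HE_homotopic n X x0 (HE_trunc n x0 K f) (HE_trunc n x0 K' f)"
    if f: "HE_map n X x0 f" and tail: "HE_tail_in n V K f" and K: "K \<le> K'" for f K K'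
  proof -
    have f0: "f HE_base = x0" using f by (simp add: HE_map_def)
    let ?F = "\<lambda>k. if k < K then \<lambda>_. x0 else f \<circ> sphere_char n k"
    have "HE_homotopic n X x0 (HE_glue n K' ?F f) (HE_trunc n x0 K' f)"
    proof (rule HE_homotopic_glue[OF n])
      show "HE_homotopic n X x0 f f" using f unfolding HE_map_iff .
      show "cube_homotopic n X x0 (?F k) (\<lambda>_. x0)" for k
        using tail_null[OF f tail, of k] const unfolding cube_map_iff by simp
    qed
    moreover have "HE_trunc n x0 K f r = HE_glue n K' ?F f r" if r: "r \<in> HE n" for r
    proof -
      obtain k t where r: "k \<ge> 1" "t \<in> cube n" "r = sphere_char n k t"
        using HE_cases[OF n r] .
      have "HE_glue n K' ?F f (sphere_char n k t) = (if k < K' then ?F k t else f (sphere_char n k t))"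
        by (rule HE_glue_sphere_char[where ?x0.0 = x0 and f = f, OF r(1,2) f0]) (use f0 in \<open>simp add: sphere_char_boundary\<close>)
      then show ?thesis
        using K HE_trunc_sphere_char[of k t n f x0 K, OF r(1,2) f0] r(3) by simp
    qed
    ultimately show ?thesis by (rule HE_homotopic_cong[OF n]) simp_all
  qed
  have trunc_sub: "HE_map n (subtopology X V) x0 (HE_trunc n x0 K f)"
    if f: "HE_map n X x0 f" and tail: "HE_tail_in n V K f" for f K
  proof -
    have f0: "f HE_base = x0" using f by (simp add: HE_map_def)
    have "HE_trunc n x0 K f r \<in> V" if r: "r \<in> HE n" for r
    proof -
      obtain k t where r: "k \<ge> 1" "t \<in> cube n" "r = sphere_char n k t"
        using HE_cases[OF n r] .
      show ?thesis
        using HE_trunc_sphere_char[of k t n f x0 K, OF r(1,2) f0] r V(2) tail by (simp add: HE_tail_in_def)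
    qed
    moreover have "HE_map n X x0 (HE_trunc n x0 K f)"
      by (rule HE_map_glue[OF n f]) (rule const)
    ultimately show ?thesis by (auto simp: HE_map_def continuous_map_in_subtopology)
  qed
  have tail_sub: "HE_tail_in n V 1 f" if "HE_map n (subtopology X V) x0 f" for f
    using that sphere_char_in_HE[OF n]
    by (auto simp: HE_tail_in_def HE_map_def continuous_map_in_subtopology image_subset_iff Pi_iff)
  have trunc_1: "HE_homotopic n X x0 (HE_trunc n x0 1 f) f" if f: "HE_map n X x0 f" for f
  proof (rule HE_homotopic_cong[OF n])
    show "HE_homotopic n X x0 f f" using f unfolding HE_map_iff .
    have f0: "f HE_base = x0" using f by (simp add: HE_map_def)
    fix r assume r: "r \<in> HE n"
    obtain k t where r: "k \<ge> 1" "t \<in> cube n" "r = sphere_char n k t"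
      using HE_cases[OF n r] .
    then show "HE_trunc n x0 1 f r = f r"
      using HE_trunc_sphere_char[of k t n f x0 1, OF r(1,2) f0] by simp
  qed simp

  \<comment> \<open>The two components of the splitting map\<close>
  define tail_class where
    "tail_class A = {h. \<exists>f\<in>A. \<exists>K. HE_tail_in n V K f \<and> HE_homotopic n X x0 (HE_trunc n x0 K f) h}" for A
  \<comment> \<open>The summands are indexed from 0 and the spheres from 1, whence the shift by
    \<open>Suc\<close>.\<close>
  define sphere_class where
    "sphere_class A k = {h. \<exists>f\<in>A. cube_homotopic n X x0 (f \<circ> sphere_char n (Suc k)) h}" for A k
  define \<Phi> where "\<Phi> A = (tail_class A, sphere_class A)" for A

  \<comment> \<open>\<open>tail_class\<close> admits all representatives and all admissible indices,
    so no choice is involved. Two of them are compared at the common index \<open>max K L\<close>: a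
    homotopy from \<open>f\<close> to \<open>g\<close> survives truncation only when both are cut at
    the same index.\<close>
  have tail_class_eq: "tail_class (HE_class n X x0 f) = HE_class n X x0 (HE_trunc n x0 K f)"
    if f: "HE_map n X x0 f" and tail: "HE_tail_in n V K f" for f K
  proof (intro equalityI subsetI)
    fix h assume "h \<in> tail_class (HE_class n X x0 f)"
    then obtain g L where g: "HE_homotopic n X x0 f g" "HE_tail_in n V L g"
      "HE_homotopic n X x0 (HE_trunc n x0 L g) h"
      by (auto simp: tail_class_def HE_class_def)
    have "HE_homotopic n X x0 (HE_trunc n x0 K f) (HE_trunc n x0 (max K L) f)"
      by (rule trunc_le[OF f tail]) simp
    also have "HE_homotopic n X x0 (HE_trunc n x0 (max K L) f) (HE_trunc n x0 (max K L) g)"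
      by (rule trunc_cong[OF g(1)])
    also have "HE_homotopic n X x0 (HE_trunc n x0 (max K L) g) (HE_trunc n x0 L g)"
      by (rule homotopic_with_symD[OF trunc_le[OF HE_homotopic_imp_map(2)[OF g(1)] g(2)]]) simp
    also note g(3)
    finally show "h \<in> HE_class n X x0 (HE_trunc n x0 K f)" by (simp add: HE_class_def)
  next
    fix h assume "h \<in> HE_class n X x0 (HE_trunc n x0 K f)"
    moreover have "f \<in> HE_class n X x0 f" using f by (simp add: HE_class_def HE_map_def)
    ultimately show "h \<in> tail_class (HE_class n X x0 f)"
      using tail unfolding tail_class_def HE_class_def by blast
  qed
  have sphere_class_eq: "sphere_class (HE_class n X x0 f) k = cube_class n X x0 (f \<circ> sphere_char n (Suc k))"
    if f: "HE_map n X x0 f" for f k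
  proof (intro equalityI subsetI)
    fix h assume "h \<in> sphere_class (HE_class n X x0 f) k"
    then obtain g where g: "HE_homotopic n X x0 f g" "cube_homotopic n X x0 (g \<circ> sphere_char n (Suc k)) h"
      by (auto simp: sphere_class_def HE_class_def)
    have "cube_homotopic n X x0 (f \<circ> sphere_char n (Suc k)) (g \<circ> sphere_char n (Suc k))"
      by (rule HE_homotopic_sphere_char[OF n _ g(1)]) simp
    from homotopic_with_trans[OF this g(2)]
    show "h \<in> cube_class n X x0 (f \<circ> sphere_char n (Suc k))" by (simp add: cube_class_def)
  next
    fix h assume "h \<in> cube_class n X x0 (f \<circ> sphere_char n (Suc k))"
    moreover have "f \<in> HE_class n X x0 f" using f by (simp add: HE_class_def HE_map_def)
    ultimately show "h \<in> sphere_class (HE_class n X x0 f) k"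
      unfolding sphere_class_def cube_class_def by blast
  qed

  \<comment> \<open>Finite support of the sphere classes\<close>
  have \<Phi>_carrier: "\<Phi> A \<in> carrier (?J \<times>\<times> ?S)" if A: "A \<in> carrier ?H" for A
  proof -
    obtain f where f: "A = HE_class n X x0 f" "HE_map n X x0 f" using A unfolding carrH by blast
    obtain K where K: "HE_tail_in n V K f" using tail_ex[OF f(2)] by blast
    have "tail_class A \<in> carrier ?J"
      unfolding carrJ f(1) tail_class_eq[OF f(2) K] using trunc_sub[OF f(2) K] by blast
    moreover have "sphere_class A \<in> carrier ?S"
      unfolding carrS
    proof (intro CollectI conjI allI)
      show "sphere_class A k \<in> carrier ?\<pi>" for k
        unfolding f(1) sphere_class_eq[OF f(2)] carr\<pi> using HE_map_sphere_char[OF n _ f(2), of "Suc k"] by auto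
      have "sphere_class A k = \<one>\<^bsub>?\<pi>\<^esub>" if "k \<ge> K" for k
        unfolding f(1) sphere_class_eq[OF f(2)] one\<pi> cube_class_eq_iff[OF const]
        by (rule tail_null[OF f(2) K]) (use that in simp)
      then have "{k. sphere_class A k \<noteq> \<one>\<^bsub>?\<pi>\<^esub>} \<subseteq> {..<K}"
        by (auto simp: not_less[symmetric])
      then show "finite {k. sphere_class A k \<noteq> \<one>\<^bsub>?\<pi>\<^esub>}"
        by (rule finite_subset) simp
    qed
    ultimately show ?thesis by (simp add: \<Phi>_def)
  qed

  \<comment> \<open>Compatibility with the operations\<close>
  have \<Phi>_mult: "\<Phi> (A \<otimes>\<^bsub>?H\<^esub> B) = \<Phi> A \<otimes>\<^bsub>?J \<times>\<times> ?S\<^esub> \<Phi> B"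
    if A: "A \<in> carrier ?H" and B: "B \<in> carrier ?H" for A B
  proof -
    obtain f where f: "A = HE_class n X x0 f" "HE_map n X x0 f" using A unfolding carrH by blast
    obtain g where g: "B = HE_class n X x0 g" "HE_map n X x0 g" using B unfolding carrH by blast
    obtain K1 K2 where "HE_tail_in n V K1 f" "HE_tail_in n V K2 g"
      using tail_ex[OF f(2)] tail_ex[OF g(2)] by blast
    then obtain K where K: "HE_tail_in n V K f" "HE_tail_in n V K g"
      using HE_tail_in_mono[of n V _ _ "max K1 K2"] by (metis max.cobounded1 max.cobounded2)
    have fg0: "f HE_base = x0" "g HE_base = x0" using f(2) g(2) by (simp_all add: HE_map_def)
    have fg: "HE_map n X x0 (HE_concat n f g)" by (rule HE_map_concat[OF n f(2) g(2)])
    have AB: "A \<otimes>\<^bsub>?H\<^esub> B = HE_class n X x0 (HE_concat n f g)"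
      unfolding f(1) g(1) by (rule mult_Hawaiian_group[OF n f(2) g(2)])
    have sph: "HE_concat n f g (sphere_char n k t) = cube_concat (f \<circ> sphere_char n k) (g \<circ> sphere_char n k) t"
      if "k \<ge> 1" "t \<in> cube n" for k t
      by (rule HE_concat_sphere_char[where f = f and g = g, OF n that fg0])
    have tail: "HE_tail_in n V K (HE_concat n f g)"
      unfolding HE_tail_in_def
    proof (intro conjI allI impI ballI)
      show K1: "K \<ge> 1" using K by (simp add: HE_tail_in_def)
      fix k t assume k: "k \<ge> K" and t: "t \<in> cube n"
      \<comment> \<open>The tail condition speaks only of points of the cube. Replacing the
        restrictions by functions that equal \<open>x0\<close> elsewhere makes both of them
        \<open>V\<close>-valued everywhere, so that membership in \<open>V\<close> is
        immediate.\<close>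
      have "cube_concat (f \<circ> sphere_char n k) (g \<circ> sphere_char n k) t
          = cube_concat (\<lambda>t. if t \<in> cube n then f (sphere_char n k t) else x0)
              (\<lambda>t. if t \<in> cube n then g (sphere_char n k t) else x0) t"
        by (rule cube_concat_cong[OF n t]) simp_all
      also have "\<dots> \<in> V"
        using K k V(2) by (simp add: cube_concat_def HE_tail_in_def)
      finally show "HE_concat n f g (sphere_char n k t) \<in> V"
        using sph[OF _ t, of k] K1 k by simp
    qed
    have "HE_homotopic n X x0 (HE_trunc n x0 K (HE_concat n f g)) (HE_concat n (HE_trunc n x0 K f) (HE_trunc n x0 K g))"
    proof (rule HE_homotopic_cong[OF n])
      show "HE_homotopic n X x0 (HE_concat n (HE_trunc n x0 K f) (HE_trunc n x0 K g))
              (HE_concat n (HE_trunc n x0 K f) (HE_trunc n x0 K g))"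
        using HE_map_concat[OF n sub_map[OF trunc_sub[OF f(2) K(1)]] sub_map[OF trunc_sub[OF g(2) K(2)]]]
        unfolding HE_map_iff .
    qed (simp_all add: HE_trunc_concat[where f = f and g = g, OF n _ fg0])
    then have "tail_class (A \<otimes>\<^bsub>?H\<^esub> B)
        = HE_class n X x0 (HE_concat n (HE_trunc n x0 K f) (HE_trunc n x0 K g))"
      unfolding AB tail_class_eq[OF fg tail]
      by (simp only: HE_class_eq_iff[OF HE_homotopic_imp_map(2)])
    also have "\<dots> = tail_class A \<otimes>\<^bsub>?H\<^esub> tail_class B"
      unfolding f(1) g(1) tail_class_eq[OF f(2) K(1)] tail_class_eq[OF g(2) K(2)]
      by (rule mult_Hawaiian_group[OF n sub_map[OF trunc_sub[OF f(2) K(1)]] sub_map[OF trunc_sub[OF g(2) K(2)]], symmetric])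
    finally have 1: "tail_class (A \<otimes>\<^bsub>?H\<^esub> B) = tail_class A \<otimes>\<^bsub>?H\<^esub> tail_class B" .
    have 2: "sphere_class (A \<otimes>\<^bsub>?H\<^esub> B) k = sphere_class A k \<otimes>\<^bsub>?\<pi>\<^esub> sphere_class B k" for k
    proof -
      have k: "Suc k \<ge> 1" by simp
      note maps = HE_map_sphere_char[OF n k f(2)] HE_map_sphere_char[OF n k g(2)]
      have cc: "cube_map n X x0 (cube_concat (f \<circ> sphere_char n (Suc k)) (g \<circ> sphere_char n (Suc k)))"
        by (rule cube_map_concat[OF n maps])
      have "cube_homotopic n X x0 (HE_concat n f g \<circ> sphere_char n (Suc k))
          (cube_concat (f \<circ> sphere_char n (Suc k)) (g \<circ> sphere_char n (Suc k)))"
        by (rule cube_homotopic_cong[OF cc[unfolded cube_map_iff]]) (use sph[OF k] in simp_all)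
      then have "sphere_class (A \<otimes>\<^bsub>?H\<^esub> B) k
          = cube_class n X x0 (cube_concat (f \<circ> sphere_char n (Suc k)) (g \<circ> sphere_char n (Suc k)))"
        unfolding AB sphere_class_eq[OF fg] by (simp only: cube_class_eq_iff[OF cc])
      then show ?thesis
        unfolding f(1) g(1) sphere_class_eq[OF f(2)] sphere_class_eq[OF g(2)] mult_homotopy_group[OF n maps] .
    qed
    show ?thesis
      by (simp add: \<Phi>_def DirProd_def 1 2 fun_eq_iff)
  qed

  \<comment> \<open>Injectivity by comparison at a common index\<close>
  have \<Phi>_inj: "inj_on \<Phi> (carrier ?H)"
  proof (rule inj_onI)
    fix A B assume A: "A \<in> carrier ?H" and B: "B \<in> carrier ?H" and eq: "\<Phi> A = \<Phi> B"
    obtain f where f: "A = HE_class n X x0 f" "HE_map n X x0 f" using A unfolding carrH by blast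
    obtain g where g: "B = HE_class n X x0 g" "HE_map n X x0 g" using B unfolding carrH by blast
    obtain K1 K2 where "HE_tail_in n V K1 f" "HE_tail_in n V K2 g"
      using tail_ex[OF f(2)] tail_ex[OF g(2)] by blast
    then obtain K where K: "HE_tail_in n V K f" "HE_tail_in n V K g"
      using HE_tail_in_mono[of n V _ _ "max K1 K2"] by (metis max.cobounded1 max.cobounded2)
    have "tail_class A = tail_class B" and sc: "sphere_class A = sphere_class B"
      using eq by (simp_all add: \<Phi>_def)
    then have "HE_class n X x0 (HE_trunc n x0 K f) = HE_class n X x0 (HE_trunc n x0 K g)"
      unfolding f(1) g(1) tail_class_eq[OF f(2) K(1)] tail_class_eq[OF g(2) K(2)] by blast
    then have "HE_homotopic n X x0 (HE_trunc n x0 K f) (HE_trunc n x0 K g)"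
      by (simp only: HE_class_eq_iff[OF sub_map[OF trunc_sub[OF g(2) K(2)]]])
    then have "HE_homotopic n X x0 f g"
    proof (rule HE_homotopic_if_trunc[OF n f(2) g(2)])
      fix k :: nat assume k: "k \<ge> 1"
      have "sphere_class A (k - 1) = sphere_class B (k - 1)" using sc by simp
      then show "cube_homotopic n X x0 (f \<circ> sphere_char n k) (g \<circ> sphere_char n k)"
        unfolding f(1) g(1) sphere_class_eq[OF f(2)] sphere_class_eq[OF g(2)]
        using k cube_class_eq_iff[OF HE_map_sphere_char[OF n k g(2)]] by simp
    qed
    then show "A = B" unfolding f(1) g(1) by (simp only: HE_class_eq_iff[OF g(2)])
  qed

  \<comment> \<open>Surjectivity by glueing\<close>
  have \<Phi>_surj: "y \<in> \<Phi> ` carrier ?H" if y: "y \<in> carrier (?J \<times>\<times> ?S)" for y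
  proof -
    obtain a b where ab: "y = (a, b)" "a \<in> carrier ?J" "b \<in> carrier ?S" using y by auto
    obtain f where f: "a = HE_class n X x0 f" "HE_map n (subtopology X V) x0 f" using ab(2) unfolding carrJ by blast
    have "\<forall>k. \<exists>g. b k = cube_class n X x0 g \<and> cube_map n X x0 g"
      using ab(3) unfolding carrS carr\<pi> by blast
    then obtain G where G: "\<And>k. b k = cube_class n X x0 (G k)" "\<And>k. cube_map n X x0 (G k)" by metis
    have "finite {k. b k \<noteq> \<one>\<^bsub>?\<pi>\<^esub>}" using ab(3) unfolding carrS by blast
    then obtain M where M: "\<And>k. b k \<noteq> \<one>\<^bsub>?\<pi>\<^esub> \<Longrightarrow> k < M"
      unfolding finite_nat_set_iff_bounded by blast
    \<comment> \<open>The components below \<open>M\<close> belong to the spheres 1 to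
      \<open>M\<close>, which are exactly those below \<open>Suc M\<close>; \<open>?G\<close> undoes
      the shift of the index.\<close>
    define K where "K = Suc M"
    let ?G = "\<lambda>k. G (k - 1)"
    let ?h = "HE_glue n K ?G f"
    note fX = sub_map[OF f(2)]
    have f0: "f HE_base = x0" using fX by (simp add: HE_map_def)
    have Gb: "G k t = x0" if "t \<in> cube_boundary n" for k t using G(2)[of k] that by (simp add: cube_map_def)
    have h: "HE_map n X x0 ?h" by (rule HE_map_glue[OF n fX G(2)])
    then have h0: "?h HE_base = x0" by (simp add: HE_map_def)
    have hs: "?h (sphere_char n k t) = (if k < K then ?G k t else f (sphere_char n k t))"
      if "k \<ge> 1" "t \<in> cube n" for k t
      by (rule HE_glue_sphere_char[where f = f and F = ?G, OF that f0 Gb])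
    have tail_f: "HE_tail_in n V K f"
      by (rule HE_tail_in_mono[OF tail_sub[OF f(2)]]) (simp add: K_def)
    have tail: "HE_tail_in n V K ?h"
      using tail_f hs by (simp add: HE_tail_in_def)
    \<comment> \<open>\<open>?h\<close> has lost the first \<open>M\<close> spheres of
      \<open>f\<close>, yet its tail class is still that of \<open>f\<close>: both have the same
      truncation at \<open>K\<close>, and as \<open>f\<close> maps into \<open>V\<close>, its index
      may be lowered to 1, where truncation changes nothing.\<close>
    have "HE_homotopic n X x0 (HE_trunc n x0 K ?h) (HE_trunc n x0 K f)"
    proof (rule HE_homotopic_cong[OF n])
      show "HE_homotopic n X x0 (HE_trunc n x0 K f) (HE_trunc n x0 K f)"
        using sub_map[OF trunc_sub[OF fX tail_f]] unfolding HE_map_iff .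
      fix r assume r: "r \<in> HE n"
      obtain k t where r: "k \<ge> 1" "t \<in> cube n" "r = sphere_char n k t"
        using HE_cases[OF n r] .
      show "HE_trunc n x0 K ?h r = HE_trunc n x0 K f r"
        using HE_trunc_sphere_char[where f = ?h, OF r(1,2) h0, of K] HE_trunc_sphere_char[where f = f, OF r(1,2) f0, of K]
          hs[OF r(1,2)] r(3) by simp
    qed simp
    also have "HE_homotopic n X x0 (HE_trunc n x0 K f) (HE_trunc n x0 1 f)"
      by (rule homotopic_with_symD[OF trunc_le[OF fX tail_sub[OF f(2)]]]) (simp add: K_def)
    also have "HE_homotopic n X x0 (HE_trunc n x0 1 f) f" by (rule trunc_1[OF fX])
    finally have 1: "tail_class (HE_class n X x0 ?h) = a"
      unfolding tail_class_eq[OF h tail] f(1) by (simp only: HE_class_eq_iff[OF fX])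
    have "sphere_class (HE_class n X x0 ?h) k = b k" for k
    proof (cases "k < M")
      case True
      have "cube_homotopic n X x0 (?h \<circ> sphere_char n (Suc k)) (G k)"
        by (rule cube_homotopic_cong[OF G(2)[of k, unfolded cube_map_iff]]) (use True hs[of "Suc k"] in \<open>simp_all add: K_def\<close>)
      then show ?thesis
        unfolding sphere_class_eq[OF h] G(1) by (simp only: cube_class_eq_iff[OF G(2)])
    next
      case False
      \<comment> \<open>From index \<open>M\<close> on the sphere comes from \<open>f\<close> and
        lies in \<open>V\<close>, so its class is trivial; by the choice of \<open>M\<close>, so is
        \<open>b k\<close>.\<close>
      have "cube_homotopic n X x0 (?h \<circ> sphere_char n (Suc k)) (\<lambda>_. x0)"
        by (rule tail_null[OF h tail]) (use False in \<open>simp add: K_def\<close>)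
      then have "sphere_class (HE_class n X x0 ?h) k = \<one>\<^bsub>?\<pi>\<^esub>"
        unfolding sphere_class_eq[OF h] one\<pi> by (simp only: cube_class_eq_iff[OF const])
      then show ?thesis using M[of k] False by metis
    qed
    then have "\<Phi> (HE_class n X x0 ?h) = y" using 1 by (simp add: \<Phi>_def ab(1) fun_eq_iff)
    moreover have "HE_class n X x0 ?h \<in> carrier ?H" using h unfolding carrH by blast
    ultimately show ?thesis by blast
  qed

  have "\<Phi> \<in> iso ?H (?J \<times>\<times> ?S)"
    unfolding iso_iff
  proof (intro conjI \<Phi>_inj equalityI subsetI)
    show "\<Phi> \<in> hom ?H (?J \<times>\<times> ?S)"
      by (rule homI[OF \<Phi>_carrier \<Phi>_mult])
  qed (use \<Phi>_carrier \<Phi>_surj in blast)+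
  then show ?thesis by (rule is_isoI)
qed

theorem theorem3p3:
  fixes X1 :: "'a topology" and x1 :: 'a and X2 :: "'b topology" and x2 :: 'b and n :: nat
  assumes "x1 \<in> topspace X1" and "x2 \<in> topspace X2" and "n \<ge> 2"
    and "semilocally_simply_connected_at n (wedge X1 x1 X2 x2) (wedge_base x1)"
  shows "\<exists>U1 U2. is_nbhd X1 x1 U1 \<and> is_nbhd X2 x2 U2 \<and>
     is_nbhd (wedge X1 x1 X2 x2) (wedge_base x1) (wedge_set U1 x1 U2 x2) \<and>
     Hawaiian_group n (wedge X1 x1 X2 x2) (wedge_base x1) \<cong>
       (Hawaiian_group n (wedge X1 x1 X2 x2) (wedge_base x1))
         \<lparr>carrier := Hawaiian_group_induced n (wedge X1 x1 X2 x2) (wedge_base x1) id `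
            carrier (Hawaiian_group n (wedge (subtopology X1 U1) x1 (subtopology X2 U2) x2) (wedge_base x1))\<rparr>
       \<times>\<times> sum_group (UNIV :: nat set) (\<lambda>_. homotopy_group n (wedge X1 x1 X2 x2) (wedge_base x1))"
proof -
  let ?X = "wedge X1 x1 X2 x2" and ?x = "wedge_base x1 :: 'a + 'b"
  have n: "n \<ge> 1" using assms(3) by simp
  obtain U where "is_nbhd ?X ?x U"
    and triv: "trivial_homomorphism (homotopy_group n (subtopology ?X U) ?x) (homotopy_group n ?X ?x)
          (homotopy_group_induced n ?X ?x id)"
    using assms(4) unfolding semilocally_simply_connected_at_def by blast
  then obtain V where V: "openin ?X V" "?x \<in> V" "V \<subseteq> U" unfolding is_nbhd_def by blast
  \<comment> \<open>The traces of \<open>V\<close> on the two summands. They are open because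
    \<open>V\<close> is, and since a subset of the wedge is covered by the images of its traces,
    \<open>V\<close> is their wedge.\<close>
  define U1 where "U1 = {a \<in> topspace X1. wedge_in1 a \<in> V}"
  define U2 where "U2 = {b \<in> topspace X2. wedge_in2 x1 x2 b \<in> V}"
  have open12: "openin X1 U1" "openin X2 U2" and Vsub: "V \<subseteq> wedge_set (topspace X1) x1 (topspace X2) x2"
    using V(1) unfolding openin_wedge U1_def U2_def by auto
  have x12: "x1 \<in> U1" "x2 \<in> U2"
    using assms(1,2) V(2) by (simp_all add: U1_def U2_def wedge_in1_def wedge_in2_def wedge_base_def)
  have set_V: "wedge_set U1 x1 U2 x2 = V"
    using Vsub by (auto simp: wedge_set_def U1_def U2_def)
  have sub: "U1 \<subseteq> topspace X1" "U2 \<subseteq> topspace X2" by (auto simp: U1_def U2_def)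
  \<comment> \<open>A cube map into \<open>V\<close> is also one into \<open>U\<close>. The induced
    class contains \<open>g\<close> itself, and triviality identifies that class with the class of
    the constant map.\<close>
  have null: "cube_homotopic n ?X ?x g (\<lambda>_. ?x)" if g: "cube_map n (subtopology ?X V) ?x g" for g
  proof -
    have gU: "cube_map n (subtopology ?X U) ?x g"
      using g V(3) unfolding cube_map_def continuous_map_in_subtopology by auto
    have gX: "cube_map n ?X ?x g"
      using g unfolding cube_map_def continuous_map_in_subtopology by auto
    let ?A = "cube_class n (subtopology ?X U) ?x g"
    have "?A \<in> carrier (homotopy_group n (subtopology ?X U) ?x)"
      using gU by (auto simp: homotopy_group_def)
    then have "homotopy_group_induced n ?X ?x id ?A = cube_class n ?X ?x (\<lambda>_. ?x)"
      using triv by (simp add: trivial_homomorphism_def homotopy_group_def)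
    moreover have "g \<in> ?A" using gU by (simp add: cube_class_def cube_map_def)
    moreover have "g \<in> cube_class n ?X ?x (id \<circ> g)" using gX by (simp add: cube_class_def cube_map_def)
    ultimately have "g \<in> cube_class n ?X ?x (\<lambda>_. ?x)"
      unfolding homotopy_group_induced_def by blast
    then show ?thesis unfolding cube_class_def by (simp add: homotopic_with_symD)
  qed
  have "Hawaiian_group n ?X ?x \<cong>
       (Hawaiian_group n ?X ?x)
         \<lparr>carrier := Hawaiian_group_induced n ?X ?x id `
            carrier (Hawaiian_group n (wedge (subtopology X1 U1) x1 (subtopology X2 U2) x2) ?x)\<rparr>
       \<times>\<times> sum_group (UNIV :: nat set) (\<lambda>_. homotopy_group n ?X ?x)"
    unfolding wedge_subtopology[OF x12(1) sub(1) x12(2) sub(2)] set_V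
    by (rule Hawaiian_group_splitting[OF n V(1,2) null])
  moreover have "is_nbhd X1 x1 U1" "is_nbhd X2 x2 U2" "is_nbhd ?X ?x (wedge_set U1 x1 U2 x2)"
    using open12 x12 sub V openin_subset[OF V(1)] unfolding set_V is_nbhd_def by blast+
  ultimately show ?thesis by blast
qed

end
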